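(* If there exists a selective ultrafilter on $\omega$, then there exists a Wallace semigroup, i.e. a countably compact Hausdorff both-sided cancellative topological semigroup which is not a topological group.
   Context: $\omega$ is the set of natural numbers and $\omega^*$ denotes the set of free (non-principal) ultrafilters on $\omega$. An ultrafilter $\mathcal U\in\omega^*$ is selective if for each partition $\{A_n:n\in\omega\}$ of $\omega$ into non-empty sets, either $A_n\in\mathcal U$ for some $n\in\omega$, or for each $n\in\omega$ there exists $a_n\in A_n$ such that $\{a_n:n\in\omega\}\in\mathcal U$. A topological space $X$ is countably compact if every infinite subset of $X$ has an accumulation point in $X$. A topological semigroup is a semigroup with a topology making the operation jointly continuous. A semigroup $S$ is both-sided cancellative if, for all $a,x,y\in S$, each of $ax=ay$ and $xa=ya$ implies $x=y$. *)

theory Defs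
  imports "HOL-Analysis.Analysis" "HOL-Algebra.Group"
begin

text \<open>
  Ultrafilters on the natural numbers are rendered as values of type \<open>nat filter\<close>;
  a set \<open>A\<close> belongs to the ultrafilter iff \<open>\<forall>\<^sub>F n in U. n \<in> A\<close>.
\<close>

definition ultrafilter :: "'a filter \<Rightarrow> bool" where
  "ultrafilter U \<longleftrightarrow>
     U \<noteq> bot \<and> (\<forall>A. (\<forall>\<^sub>F x in U. x \<in> A) \<or> (\<forall>\<^sub>F x in U. x \<notin> A))"

definition free_ultrafilter :: "'a filter \<Rightarrow> bool" where
  "free_ultrafilter U \<longleftrightarrow> ultrafilter U \<and> (\<forall>x. U \<noteq> principal {x})"

text \<open>
  The pieces \<open>A n\<close> of a partition are pairwise disjoint as an indexed family, so
  distinct indices give distinct pieces.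
\<close>

definition selective_ultrafilter :: "nat filter \<Rightarrow> bool" where
  "selective_ultrafilter U \<longleftrightarrow>
     free_ultrafilter U \<and>
     (\<forall>A :: nat \<Rightarrow> nat set.
        disjoint_family A \<and> (\<forall>n. A n \<noteq> {}) \<and> (\<Union>n. A n) = UNIV \<longrightarrow>
          (\<exists>n. \<forall>\<^sub>F k in U. k \<in> A n) \<or>
          (\<exists>a. (\<forall>n. a n \<in> A n) \<and> (\<forall>\<^sub>F k in U. k \<in> range a)))"

definition countably_compact_space :: "'a topology \<Rightarrow> bool" where
  "countably_compact_space X \<longleftrightarrow>
     (\<forall>A \<subseteq> topspace X. infinite A \<longrightarrow> X derived_set_of A \<noteq> {})"

text \<open>
  Semigroups are required to be non-empty; the empty set would otherwise be a
  degenerate Wallace semigroup.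
\<close>

definition semigroup_on :: "'a set \<Rightarrow> ('a \<Rightarrow> 'a \<Rightarrow> 'a) \<Rightarrow> bool" where
  "semigroup_on S f \<longleftrightarrow>
     S \<noteq> {} \<and>
     (\<forall>x\<in>S. \<forall>y\<in>S. f x y \<in> S) \<and>
     (\<forall>x\<in>S. \<forall>y\<in>S. \<forall>z\<in>S. f (f x y) z = f x (f y z))"

definition cancellative_on :: "'a set \<Rightarrow> ('a \<Rightarrow> 'a \<Rightarrow> 'a) \<Rightarrow> bool" where
  "cancellative_on S f \<longleftrightarrow>
     (\<forall>a\<in>S. \<forall>x\<in>S. \<forall>y\<in>S. (f a x = f a y \<longrightarrow> x = y) \<and> (f x a = f y a \<longrightarrow> x = y))"

definition topological_semigroup :: "'a topology \<Rightarrow> ('a \<Rightarrow> 'a \<Rightarrow> 'a) \<Rightarrow> bool" where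
  "topological_semigroup X f \<longleftrightarrow>
     semigroup_on (topspace X) f \<and>
     continuous_map (prod_topology X X) X (\<lambda>(x, y). f x y)"

definition topological_group :: "'a topology \<Rightarrow> ('a \<Rightarrow> 'a \<Rightarrow> 'a) \<Rightarrow> bool" where
  "topological_group X f \<longleftrightarrow>
     (\<exists>e. let G = \<lparr>carrier = topspace X, mult = f, one = e\<rparr> in
        group G \<and>
        continuous_map (prod_topology X X) X (\<lambda>(x, y). x \<otimes>\<^bsub>G\<^esub> y) \<and>
        continuous_map X X (\<lambda>x. inv\<^bsub>G\<^esub> x))"

definition wallace_semigroup :: "'a topology \<Rightarrow> ('a \<Rightarrow> 'a \<Rightarrow> 'a) \<Rightarrow> bool" where
  "wallace_semigroup X f \<longleftrightarrow>
     topological_semigroup X f \<and>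
     countably_compact_space X \<and>
     Hausdorff_space X \<and>
     cancellative_on (topspace X) f \<and>
     \<not> topological_group X f"

text \<open>
  The carrier of a Wallace semigroup is \<open>topspace X\<close>, an arbitrary subset of the
  underlying type.  An existence claim therefore has to name an ambient type; any type of
  cardinality continuum, such as \<open>real\<close>, is large enough.  Indeed, given a Wallace
  semigroup of any size, an elementary submodel of cardinality continuum that is closed
  under countable sequences yields one of size at most continuum: intersect the semigroup
  with the submodel and take the topology generated by the traces of the open sets that
  belong to the submodel.
\<close>

end

theory Submission
  imports Defs
begin

text \<open>
  Write \<open>F(E)\<close> for the free commutative monoid on a set \<open>E\<close>, that is, the finite multisets
  over \<open>E\<close>.  The Wallace semigroup is \<open>F(node)\<close> for a suitable set \<open>node\<close> of cardinality
  continuum, with the coarsest topology that makes a certain set \<open>X\<close> of characters (homomorphisms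
  into the unit circle) continuous.  A free commutative monoid is cancellative and is not a group, and
  multiplication of values makes the operation continuous; so \<open>X\<close> has only two jobs.  It must
  separate points, for the Hausdorff property, and every infinite subset of \<open>F(node)\<close> must have an
  accumulation point.
  
  Fix a selective ultrafilter \<open>U\<close>.  For the second job, every injective sequence \<open>a\<close> of multisets
  gets its own generator \<open>Limit a\<close>, and \<open>X\<close> consists of the characters \<open>\<phi>\<close> such that,
  along \<open>U\<close>, \<open>\<phi>\<close> of a chosen reparametrization \<open>a (h a k)\<close> of \<open>a\<close> tends to
  \<open>\<phi> (Limit a)\<close>.  Generators are thus built from sequences of multisets of generators, which
  makes \<open>node\<close> an infinitely branching datatype: its well-foundedness allows characters to be defined
  by recursion, and its cardinality is the continuum.
  
  The difficulty is that \<open>X\<close> has to separate points.  If the chosen sequences satisfied a linear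
  relation modulo \<open>U\<close>, their limits would have to satisfy it too, and the characters could not tell
  the two sides apart.  Therefore the reparametrizations are chosen by transfinite recursion so that, modulo
  \<open>U\<close>, all the sequences together with the constants are linearly independent
  (\<open>independent_branches_exist\<close>): each \<open>a\<close> has continuum many reparametrizations, and fewer than
  continuum many are excluded at each step.
  
  Given independence, let multisets \<open>d \<noteq> d'\<close> be given.  Only countably many generators occur
  hereditarily in \<open>d\<close> and \<open>d'\<close>; it suffices to define \<open>\<phi>\<close> on these, and
  \<open>extend_char\<close> then extends it recursively to all other generators by taking limits along
  \<open>U\<close>.  On the countable set, \<open>\<phi>\<close> is a limit of approximations, each of which satisfies finitely
  many of the required relations up to a small error.  A Kronecker type theorem
  (\<open>kronecker_multisets\<close>), proved by Fourier analysis on finite grids of roots of unity, shows that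
  independence lets one satisfy, for \<open>U\<close>-almost all \<open>k\<close>, finitely many new approximate
  relations at the index \<open>k\<close> while the finitely many old values move only slightly.  Since the set of
  suitable \<open>k\<close> depends on the indices used before, one has to choose the indices so that all of them
  together still form a set in \<open>U\<close>.  This is the only place that needs selectivity, in the form of the
  diagonal property \<open>selective_diagonal\<close>.
\<close>

section \<open>Selective ultrafilters\<close>

lemma ultrafilter_not_eventually:
  "ultrafilter U \<Longrightarrow> \<not> (\<forall>\<^sub>F x in U. P x) \<longleftrightarrow> (\<forall>\<^sub>F x in U. \<not> P x)"
proof
  assume U: "ultrafilter U" and "\<not> (\<forall>\<^sub>F x in U. P x)"
  then have "\<not> (\<forall>\<^sub>F x in U. x \<in> Collect P)" by simp
  then have "\<forall>\<^sub>F x in U. x \<notin> Collect P"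
    using U unfolding ultrafilter_def by blast
  then show "\<forall>\<^sub>F x in U. \<not> P x" by simp
next
  assume U: "ultrafilter U" and not: "\<forall>\<^sub>F x in U. \<not> P x"
  show "\<not> (\<forall>\<^sub>F x in U. P x)"
  proof
    assume "\<forall>\<^sub>F x in U. P x"
    with not have "\<forall>\<^sub>F x in U. False" by eventually_elim simp
    with U show False by (simp add: ultrafilter_def trivial_limit_def)
  qed
qed

lemma ultrafilter_finite_cases:
  assumes "ultrafilter U" "finite S" "\<forall>\<^sub>F x in U. \<exists>s\<in>S. P s x"
  shows "\<exists>s\<in>S. \<forall>\<^sub>F x in U. P s x"
proof (rule ccontr)
  assume "\<not> ?thesis"
  then have "\<forall>s\<in>S. \<forall>\<^sub>F x in U. \<not> P s x"
    using ultrafilter_not_eventually[OF assms(1)] by blast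
  then have "\<forall>\<^sub>F x in U. \<forall>s\<in>S. \<not> P s x"
    using assms(2) by (simp add: eventually_ball_finite_distrib)
  with assms(3) have "\<forall>\<^sub>F x in U. False"
    by eventually_elim blast
  with assms(1) show False
    by (simp add: ultrafilter_def trivial_limit_def)
qed

lemma free_ultrafilter_avoids_finite:
  assumes "free_ultrafilter U" "finite S"
  shows "\<forall>\<^sub>F x in U. x \<notin> S"
proof -
  have U: "ultrafilter U" and free: "\<And>x. U \<noteq> principal {x}"
    using assms(1) by (auto simp: free_ultrafilter_def)
  have "\<forall>\<^sub>F x in U. x \<noteq> s" for s
  proof (rule ccontr)
    assume "\<not> ?thesis"
    then have ev: "\<forall>\<^sub>F x in U. x = s"
      using ultrafilter_not_eventually[OF U] by auto
    have "eventually P U \<longleftrightarrow> P s" for P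
    proof
      assume "eventually P U"
      with ev have "\<forall>\<^sub>F x in U. P s" by eventually_elim simp
      with U show "P s" by (simp add: ultrafilter_def)
    next
      assume "P s"
      with ev show "eventually P U" by (auto elim: eventually_mono)
    qed
    then have "U = principal {s}"
      by (simp add: filter_eq_iff eventually_principal)
    with free show False by blast
  qed
  then have "\<forall>\<^sub>F x in U. \<forall>s\<in>S. x \<noteq> s"
    using assms(2) by (simp add: eventually_ball_finite_distrib)
  then show ?thesis by eventually_elim blast
qed

text \<open>
  The filter generated by \<open>f\<close> has a cluster point in the compact set, and an ultrafilter
  converges to each of its cluster points.
\<close>

lemma ultrafilter_tendsto_compact:
  fixes f :: "'a \<Rightarrow> 'b::topological_space"
  assumes "ultrafilter U" "compact K" "\<And>x. f x \<in> K"
  shows "\<exists>l\<in>K. (f \<longlongrightarrow> l) U"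
proof -
  have "filtermap f U \<noteq> bot"
    using assms(1) by (simp add: ultrafilter_def filtermap_bot_iff)
  moreover have "\<forall>\<^sub>F y in filtermap f U. y \<in> K"
    using assms(3) by (simp add: eventually_filtermap)
  ultimately obtain l where l: "l \<in> K" "inf (nhds l) (filtermap f U) \<noteq> bot"
    using assms(2) unfolding compact_filter by blast
  have "eventually (\<lambda>x. f x \<in> S) U" if "open S" "l \<in> S" for S
  proof (rule ccontr)
    assume "\<not> ?thesis"
    then have "\<forall>\<^sub>F y in filtermap f U. y \<notin> S"
      using ultrafilter_not_eventually[OF assms(1)] by (simp add: eventually_filtermap)
    moreover have "\<forall>\<^sub>F y in nhds l. y \<in> S"
      using that by (rule eventually_nhds_in_open)
    ultimately have "eventually (\<lambda>_. False) (inf (nhds l) (filtermap f U))"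
      unfolding eventually_inf by blast
    with l(2) show False by (simp add: trivial_limit_def)
  qed
  then show ?thesis using l(1) by (auto simp: tendsto_def)
qed

text \<open>
  The fibres of \<open>g\<close> form the partition: there are infinitely many, because none of them belongs to
  \<open>U\<close>, and the selector provided by selectivity meets every fibre once.
\<close>

lemma selective_injective_on:
  assumes "selective_ultrafilter U" and "\<And>n. \<forall>\<^sub>F k in U. g k \<noteq> (n::nat)"
  shows "\<exists>B. (\<forall>\<^sub>F k in U. k \<in> B) \<and> inj_on g B"
proof -
  have sel: "\<And>A :: nat \<Rightarrow> nat set. disjoint_family A \<Longrightarrow> (\<forall>n. A n \<noteq> {}) \<Longrightarrow> (\<Union>n. A n) = UNIV \<Longrightarrow>
          (\<exists>n. \<forall>\<^sub>F k in U. k \<in> A n) \<or>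
          (\<exists>a. (\<forall>n. a n \<in> A n) \<and> (\<forall>\<^sub>F k in U. k \<in> range a))"
    and U: "ultrafilter U"
    using assms(1) by (auto simp: selective_ultrafilter_def free_ultrafilter_def)
  have inf: "infinite (range g)"
  proof
    assume "finite (range g)"
    then have "\<forall>\<^sub>F k in U. \<forall>n\<in>range g. g k \<noteq> n"
      by (rule eventually_ball_finite) (use assms(2) in blast)
    then have "\<forall>\<^sub>F k in U. False" by eventually_elim auto
    with U show False by (simp add: ultrafilter_def trivial_limit_def)
  qed
  have inj: "enumerate (range g) m = enumerate (range g) n \<Longrightarrow> m = n" for m n
    using strict_mono_eq[OF strict_mono_enumerate[OF inf]] by simp
  define A where "A n = {k. g k = enumerate (range g) n}" for n
  have "disjoint_family A"
    unfolding disjoint_family_on_def A_def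
    using inj by auto
  moreover have "A n \<noteq> {}" for n
    using enumerate_in_set[OF inf, of n] by (auto simp: A_def)
  moreover have "(\<Union>n. A n) = UNIV"
  proof -
    have "\<exists>n. g k = enumerate (range g) n" for k
      using range_enumerate[OF inf] by (metis rangeI imageE)
    then show ?thesis by (auto simp: A_def)
  qed
  moreover have "\<not> (\<forall>\<^sub>F k in U. k \<in> A n)" for n
    using assms(2)[of "enumerate (range g) n"] ultrafilter_not_eventually[OF U] by (simp add: A_def)
  ultimately obtain a where a: "\<And>n. a n \<in> A n" "\<forall>\<^sub>F k in U. k \<in> range a"
    using sel[of A] by blast
  have "inj_on g (range a)"
  proof (rule inj_onI)
    fix x y assume "x \<in> range a" "y \<in> range a" "g x = g y"
    then obtain m n where mn: "x = a m" "y = a n" by auto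
    then have "enumerate (range g) m = enumerate (range g) n"
      using a(1)[of m] a(1)[of n] \<open>g x = g y\<close> by (auto simp: A_def)
    then have "m = n" by (rule inj)
    then show "x = y" using mn by simp
  qed
  then show ?thesis using a(2) by blast
qed

text \<open>
  Selectivity is used twice.  Making \<open>g\<close>, the level at which a point leaves the decreasing
  intersections \<open>Q n\<close>, injective on a set \<open>B\<close> in \<open>U\<close> makes \<open>B\<close> almost contained in each
  \<open>Q n\<close>, with exceptions below some bound \<open>f n\<close>.  Cutting the numbers into blocks that grow
  faster than \<open>f\<close> and choosing at most one point per block spaces out the points; keeping only blocks
  of one parity ensures that \<open>f a < b\<close> for any two chosen points \<open>a < b\<close>.
\<close>

lemma selective_diagonal:
  assumes sel: "selective_ultrafilter U" and P: "\<And>n. \<forall>\<^sub>F k in U. k \<in> P n"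
  shows "\<exists>A. (\<forall>\<^sub>F k in U. k \<in> A) \<and> (\<forall>a\<in>A. \<forall>b\<in>A. a < b \<longrightarrow> b \<in> P a)"
proof -
  have U: "ultrafilter U" and free: "free_ultrafilter U"
    using sel by (auto simp: selective_ultrafilter_def free_ultrafilter_def)
  define Q where "Q n = {k. n < k \<and> (\<forall>i\<le>n. k \<in> P i)}" for n
  have Q: "\<forall>\<^sub>F k in U. k \<in> Q n" for n
  proof -
    have "\<forall>\<^sub>F k in U. k \<notin> {..n}"
      using free by (rule free_ultrafilter_avoids_finite) simp
    moreover have "\<forall>\<^sub>F k in U. \<forall>i\<in>{..n}. k \<in> P i"
      using P by (simp add: eventually_ball_finite_distrib)
    ultimately show ?thesis by eventually_elim (auto simp: Q_def)
  qed
  define g where "g k = (LEAST n. k \<notin> Q n)" for k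
  have g: "k \<notin> Q (g k)" for k
    unfolding g_def by (rule LeastI[of _ k]) (simp add: Q_def)
  have "\<forall>\<^sub>F k in U. g k \<noteq> n" for n
    using Q[of n] by eventually_elim (use g in auto)
  then obtain B where B: "\<forall>\<^sub>F k in U. k \<in> B" "inj_on g B"
    using selective_injective_on[OF sel] by blast
  have fin: "finite (B - Q n)" for n
  proof (rule finite_imageD)
    have "g ` (B - Q n) \<subseteq> {..n}"
      unfolding g_def by (auto intro: Least_le)
    then show "finite (g ` (B - Q n))" by (rule finite_subset) simp
    show "inj_on g (B - Q n)" using B(2) by (rule inj_on_subset) auto
  qed
  have finI: "finite (insert n (\<Union>i\<le>n. B - Q i))" for n
    by (intro finite.insertI finite_UN_I fin) simp
  define f where "f n = Max (insert n (\<Union>i\<le>n. B - Q i))" for n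
  have f: "k \<in> Q n" if "k \<in> B" "f n < k" for n k
  proof (rule ccontr)
    assume "k \<notin> Q n"
    then have "k \<le> f n"
      unfolding f_def using that by (intro Max_ge finI) auto
    with that show False by simp
  qed
  have fmono: "f m \<le> f n" if "m \<le> n" for m n
  proof -
    have "f m \<in> insert m (\<Union>i\<le>m. B - Q i)"
      unfolding f_def by (intro Max_in finI) auto
    then have "f m = m \<or> f m \<in> (\<Union>i\<le>n. B - Q i)" using that by force
    moreover have "n \<le> f n" unfolding f_def by (intro Max_ge finI) auto
    moreover have "x \<le> f n" if "x \<in> (\<Union>i\<le>n. B - Q i)" for x
      unfolding f_def using that by (intro Max_ge finI) auto
    ultimately show ?thesis using that by force
  qed
  define s where "s j = ((\<lambda>x. Suc (f x)) ^^ j) 0" for j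
  have s_Suc: "s (Suc j) = Suc (f (s j))" for j by (simp add: s_def)
  have fge: "n \<le> f n" for n unfolding f_def by (intro Max_ge finI) auto
  have smono: "strict_mono s"
    by (rule strict_monoI_Suc) (use s_Suc fge in \<open>auto simp: less_Suc_eq_le\<close>)
  define blk where "blk k = (LEAST j. k < s (Suc j))" for k
  have blk_lt: "k < s (Suc (blk k))" for k
  proof -
    have "k < s (Suc k)" using smono strict_mono_imp_increasing[of s "Suc k"] by simp
    then show ?thesis unfolding blk_def by (rule LeastI)
  qed
  have blk_ge: "s (blk k) \<le> k" for k
  proof (cases "blk k")
    case 0 then show ?thesis by (simp add: s_def)
  next
    case (Suc j)
    then have "j < (LEAST j. k < s (Suc j))" unfolding blk_def by simp
    then have "\<not> k < s (Suc j)" by (rule not_less_Least)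
    then show ?thesis using Suc by simp
  qed
  have "\<forall>\<^sub>F k in U. blk k \<noteq> j" for j
  proof -
    have "\<forall>\<^sub>F k in U. k \<notin> {..<s (Suc j)}"
      using free by (rule free_ultrafilter_avoids_finite) simp
    then show ?thesis by eventually_elim (use blk_lt in auto)
  qed
  then obtain D where D: "\<forall>\<^sub>F k in U. k \<in> D" "inj_on blk D"
    using selective_injective_on[OF sel] by blast
  \<comment> \<open>Points in neighbouring blocks may be too close together; one parity class of blocks lies in \<open>U\<close>.\<close>
  have "\<exists>par\<in>{True, False}. \<forall>\<^sub>F k in U. even (blk k) = par"
    by (rule ultrafilter_finite_cases[OF U]) auto
  then obtain par where par: "\<forall>\<^sub>F k in U. even (blk k) = par" by blast
  define A where "A = {k. k \<in> B \<and> k \<in> D \<and> even (blk k) = par}"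
  have "\<forall>\<^sub>F k in U. k \<in> A"
    using B(1) D(1) par by eventually_elim (simp add: A_def)
  moreover have "b \<in> P a" if "a \<in> A" "b \<in> A" "a < b" for a b
  proof -
    have "blk a \<le> blk b"
      unfolding blk_def by (rule Least_le) (use blk_lt[of b] that in \<open>simp add: blk_def\<close>)
    moreover have "blk a \<noteq> blk b" using that D(2) by (auto simp: A_def inj_on_def)
    moreover have "blk b \<noteq> Suc (blk a)" using that by (auto simp: A_def)
    ultimately have "Suc (Suc (blk a)) \<le> blk b" by linarith
    then have "s (Suc (Suc (blk a))) \<le> s (blk b)"
      using smono by (simp add: strict_mono_less_eq)
    also have "\<dots> \<le> b" by (rule blk_ge)
    finally have "f (s (Suc (blk a))) < b" by (simp add: s_Suc)
    moreover have "f a \<le> f (s (Suc (blk a)))" using blk_lt[of a] by (intro fmono) simp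
    ultimately have "b \<in> Q a" using that by (intro f) (auto simp: A_def)
    then show ?thesis by (simp add: Q_def)
  qed
  ultimately show ?thesis by blast
qed

section \<open>Characters of free commutative monoids and approximate solutions of relations\<close>

definition unimodular :: "('e \<Rightarrow> complex) \<Rightarrow> bool" where
  "unimodular \<phi> \<longleftrightarrow> (\<forall>e. norm (\<phi> e) = 1)"

definition char_ext :: "('e \<Rightarrow> complex) \<Rightarrow> 'e multiset \<Rightarrow> complex" where
  "char_ext \<phi> M = prod_mset (image_mset \<phi> M)"

lemma char_ext_empty [simp]: "char_ext \<phi> {#} = 1"
  and char_ext_add [simp]: "char_ext \<phi> (M + N) = char_ext \<phi> M * char_ext \<phi> N"
  and char_ext_single [simp]: "char_ext \<phi> {#e#} = \<phi> e"
  and char_ext_add_mset [simp]: "char_ext \<phi> (add_mset e M) = \<phi> e * char_ext \<phi> M"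
  by (simp_all add: char_ext_def)

lemma char_ext_repeat [simp]: "char_ext \<phi> (repeat_mset n M) = char_ext \<phi> M ^ n"
  by (induction n) auto

lemma char_ext_sum: "char_ext \<phi> (\<Sum>j\<in>J. M j) = (\<Prod>j\<in>J. char_ext \<phi> (M j))"
  by (induction J rule: infinite_finite_induct) auto

lemma norm_char_ext_eq_1: "(\<And>e. e \<in># M \<Longrightarrow> norm (\<phi> e) = 1) \<Longrightarrow> norm (char_ext \<phi> M) = 1"
  by (induction M) (auto simp: norm_mult)

lemma norm_char_ext: "unimodular \<phi> \<Longrightarrow> norm (char_ext \<phi> M) = 1"
  by (simp add: unimodular_def norm_char_ext_eq_1)

lemma char_ext_cong: "(\<And>e. e \<in># M \<Longrightarrow> \<phi> e = \<psi> e) \<Longrightarrow> char_ext \<phi> M = char_ext \<psi> M"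
  by (induction M) auto

lemma char_ext_prod:
  assumes "finite F" "set_mset M \<subseteq> F"
  shows "char_ext \<phi> M = (\<Prod>e\<in>F. \<phi> e ^ count M e)"
  unfolding char_ext_def image_prod_mset_multiplicity
  using assms by (intro prod.mono_neutral_left) (auto simp: not_in_iff)

lemma roots_of_unity_orthogonal:
  fixes m n N :: nat
  assumes "m < N" "n < N"
  defines "\<omega> \<equiv> \<lambda>x. cis (2 * pi * real x / real N)"
  shows "(\<Sum>x<N. \<omega> x ^ m * cnj (\<omega> x ^ n)) = (if m = n then of_nat N else 0)"
proof -
  define \<rho> where "\<rho> = cis (2 * pi * (real m - real n) / real N)"
  have summand: "\<omega> x ^ m * cnj (\<omega> x ^ n) = \<rho> ^ x" for x
  proof -
    have "\<omega> x ^ m * cnj (\<omega> x ^ n) = cis (real m * (2 * pi * real x / real N) - real n * (2 * pi * real x / real N))"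
      unfolding \<omega>_def by (simp add: Complex.DeMoivre cis_cnj cis_mult del: complex_cnj_power)
    also have "real m * (2 * pi * real x / real N) - real n * (2 * pi * real x / real N)
        = real x * (2 * pi * (real m - real n) / real N)"
      by (simp add: algebra_simps diff_divide_distrib)
    finally show ?thesis by (simp add: \<rho>_def Complex.DeMoivre)
  qed
  show ?thesis
  proof (cases "m = n")
    case True
    then have "\<rho> = 1" by (simp add: \<rho>_def)
    with True show ?thesis unfolding summand by simp
  next
    case False
    have "\<rho> \<noteq> 1"
    proof
      assume "\<rho> = 1"
      then have "cis (2 * pi * real m / real N) = cis (2 * pi * real n / real N)"
        unfolding \<rho>_def by (simp add: diff_divide_distrib right_diff_distrib flip: cis_divide)
      then have "m mod N = n mod N"
        using complex_root_unity_eq[of N m n] assms by (simp add: cis_conv_exp mult_ac)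
      with assms False show False by simp
    qed
    moreover have "\<rho> ^ N = 1"
    proof -
      have "\<rho> ^ N = cis (2 * pi * (real_of_int (int m - int n)))"
        unfolding \<rho>_def using assms by (simp add: Complex.DeMoivre)
      also have "\<dots> = 1"
        by (rule cis_multiple_2pi) simp
      finally show ?thesis .
    qed
    ultimately have "(\<Sum>x<N. \<rho> ^ x) = 0" by (simp add: geometric_sum)
    with False show ?thesis unfolding summand by simp
  qed
qed

text \<open>
  Distinct monomials are orthogonal under the Haar measure of the torus.  For finitely many multisets,
  averaging over a grid of \<open>N\<close>-th roots of unity has the same effect once \<open>N\<close> exceeds all
  multiplicities.  The index \<open>a\<close> of a sample gives the exponents of the root at each generator.
\<close>

lemma orthogonal_sampling:
  fixes \<N> :: "'e multiset set"
  assumes "finite \<N>"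
  shows "\<exists>(\<Gamma> :: ('e \<Rightarrow> nat) set) \<Phi>. finite \<Gamma> \<and> \<Gamma> \<noteq> {} \<and> (\<forall>a. unimodular (\<Phi> a)) \<and>
     (\<forall>A\<in>\<N>. \<forall>B\<in>\<N>. (\<Sum>a\<in>\<Gamma>. char_ext (\<Phi> a) A * cnj (char_ext (\<Phi> a) B))
                     = (if A = B then of_nat (card \<Gamma>) else 0))"
proof -
  define F where "F = (\<Union>A\<in>\<N>. set_mset A)"
  define N where "N = Suc (\<Sum>A\<in>\<N>. size A)"
  define \<omega> where "\<omega> x = cis (2 * pi * real x / real N)" for x
  define \<Phi> where "\<Phi> a e = \<omega> (a e)" for a and e :: 'e
  define \<Gamma> where "\<Gamma> = PiE F (\<lambda>_. {..<N})"
  have finF: "finite F" using assms by (simp add: F_def)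
  have less: "count A e < N" if "A \<in> \<N>" for A e
  proof -
    have "count A e \<le> size A" by (rule count_le_size)
    also have "\<dots> \<le> (\<Sum>A\<in>\<N>. size A)" using that assms by (simp add: member_le_sum)
    finally show ?thesis by (simp add: N_def)
  qed
  have fin: "finite \<Gamma>" using finF by (simp add: \<Gamma>_def finite_PiE)
  have ne: "\<Gamma> \<noteq> {}" by (auto simp: \<Gamma>_def PiE_eq_empty_iff N_def)
  have uni: "unimodular (\<Phi> a)" for a by (simp add: unimodular_def \<Phi>_def \<omega>_def)
  have "(\<Sum>a\<in>\<Gamma>. char_ext (\<Phi> a) A * cnj (char_ext (\<Phi> a) B)) = (if A = B then of_nat (card \<Gamma>) else 0)"
    if AB: "A \<in> \<N>" "B \<in> \<N>" for A B
  proof -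
    have sub: "set_mset A \<subseteq> F" "set_mset B \<subseteq> F" using AB by (auto simp: F_def)
    have "(\<Sum>a\<in>\<Gamma>. char_ext (\<Phi> a) A * cnj (char_ext (\<Phi> a) B)) =
          (\<Sum>a\<in>\<Gamma>. \<Prod>e\<in>F. \<omega> (a e) ^ count A e * cnj (\<omega> (a e) ^ count B e))"
      by (simp add: char_ext_prod[OF finF] sub prod.distrib \<Phi>_def)
    also have "\<dots> = (\<Prod>e\<in>F. \<Sum>x<N. \<omega> x ^ count A e * cnj (\<omega> x ^ count B e))"
      unfolding \<Gamma>_def by (rule prod_sum_PiE[symmetric]) (use finF in auto)
    also have "\<dots> = (\<Prod>e\<in>F. if count A e = count B e then of_nat N else 0)"
      using roots_of_unity_orthogonal[OF less[OF AB(1)] less[OF AB(2)]]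
      by (simp add: \<omega>_def)
    also have "\<dots> = (if A = B then of_nat (card \<Gamma>) else 0)"
    proof (cases "A = B")
      case True
      then show ?thesis using finF by (simp add: \<Gamma>_def card_PiE)
    next
      case False
      then obtain e where e: "count A e \<noteq> count B e" by (auto simp: multiset_eq_iff)
      then have "e \<in># A \<or> e \<in># B" by (metis count_eq_zero_iff)
      then have "e \<in> F" using sub by blast
      then have "(\<Prod>e\<in>F. if count A e = count B e then of_nat N else 0) = (0::complex)"
        using e finF by (intro prod_zero) auto
      with False show ?thesis by simp
    qed
    finally show ?thesis .
  qed
  with fin ne uni show ?thesis by blast
qed

lemma parseval_sampling:
  fixes N :: "'q \<Rightarrow> 'e multiset"
  assumes "finite Q" "inj_on N Q"
  shows "\<exists>(\<Gamma> :: ('e \<Rightarrow> nat) set) \<Phi>. finite \<Gamma> \<and> \<Gamma> \<noteq> {} \<and> (\<forall>a. unimodular (\<Phi> a)) \<and>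
     (\<forall>c. (\<Sum>a\<in>\<Gamma>. (norm (\<Sum>q\<in>Q. c q * char_ext (\<Phi> a) (N q)))\<^sup>2)
           = real (card \<Gamma>) * (\<Sum>q\<in>Q. (norm (c q))\<^sup>2))"
proof -
  obtain \<Gamma> :: "('e \<Rightarrow> nat) set" and \<Phi> where \<Gamma>: "finite \<Gamma>" "\<Gamma> \<noteq> {}" "\<forall>a. unimodular (\<Phi> a)"
    and orth: "\<And>A B. A \<in> N ` Q \<Longrightarrow> B \<in> N ` Q \<Longrightarrow>
       (\<Sum>a\<in>\<Gamma>. char_ext (\<Phi> a) A * cnj (char_ext (\<Phi> a) B)) = (if A = B then of_nat (card \<Gamma>) else 0)"
    using orthogonal_sampling[OF finite_imageI[OF assms(1), of N]] by blast
  have "(\<Sum>a\<in>\<Gamma>. (norm (\<Sum>q\<in>Q. c q * char_ext (\<Phi> a) (N q)))\<^sup>2)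
           = real (card \<Gamma>) * (\<Sum>q\<in>Q. (norm (c q))\<^sup>2)" for c
  proof -
    define X where "X a q = char_ext (\<Phi> a) (N q)" for a q
    have "complex_of_real (\<Sum>a\<in>\<Gamma>. (norm (\<Sum>q\<in>Q. c q * X a q))\<^sup>2)
        = (\<Sum>a\<in>\<Gamma>. (\<Sum>q\<in>Q. c q * X a q) * cnj (\<Sum>r\<in>Q. c r * X a r))"
      by (simp only: of_real_sum complex_norm_square)
    also have "\<dots> = (\<Sum>a\<in>\<Gamma>. \<Sum>q\<in>Q. \<Sum>r\<in>Q. c q * cnj (c r) * (X a q * cnj (X a r)))"
      unfolding cnj_sum sum_product by (intro sum.cong refl) (simp add: mult_ac)
    also have "\<dots> = (\<Sum>q\<in>Q. \<Sum>a\<in>\<Gamma>. \<Sum>r\<in>Q. c q * cnj (c r) * (X a q * cnj (X a r)))"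
      by (rule sum.swap)
    also have "\<dots> = (\<Sum>q\<in>Q. \<Sum>r\<in>Q. \<Sum>a\<in>\<Gamma>. c q * cnj (c r) * (X a q * cnj (X a r)))"
      by (intro sum.cong refl sum.swap)
    also have "\<dots> = (\<Sum>q\<in>Q. \<Sum>r\<in>Q. c q * cnj (c r) * (\<Sum>a\<in>\<Gamma>. X a q * cnj (X a r)))"
      by (simp only: sum_distrib_left)
    also have "\<dots> = (\<Sum>q\<in>Q. \<Sum>r\<in>Q. if q = r then c q * cnj (c q) * of_nat (card \<Gamma>) else 0)"
      using orth assms(2) by (intro sum.cong refl) (auto simp: X_def inj_on_def)
    also have "\<dots> = (\<Sum>q\<in>Q. c q * cnj (c q) * of_nat (card \<Gamma>))"
      using assms(1) by simp
    also have "\<dots> = complex_of_real (real (card \<Gamma>) * (\<Sum>q\<in>Q. (norm (c q))\<^sup>2))"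
      by (simp only: of_real_sum of_real_mult complex_norm_square of_real_of_nat_eq sum_distrib_right
            mult.commute[of "of_nat (card \<Gamma>)"])
    finally show ?thesis unfolding X_def of_real_eq_iff .
  qed
  with \<Gamma> show ?thesis by blast
qed

text \<open>
  The conclusion says that all the relations \<open>\<phi>(p j) = z j * \<phi>(q j)\<close> can be satisfied
  approximately.  The test function is the squared modulus of
  \<open>\<Prod>j\<in>J. (\<phi>(p j) + z j * \<phi>(q j)) ^ M\<close>, which is concentrated on the solutions of the
  relations.  By the injectivity hypothesis its expansion has pairwise distinct monomials, so by
  Parseval its mean is a power of the central binomial coefficient, about \<open>4 ^ (M * card J)\<close> up to
  a polynomial factor in \<open>M\<close>.  If every \<open>\<phi>\<close> violated one of the relations by \<open>\<delta>\<close>, the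
  corresponding factor would make the function exponentially smaller than that everywhere.
\<close>

lemma kronecker_multisets:
  fixes p q :: "'j \<Rightarrow> 'e multiset"
  assumes J: "finite J" and \<delta>: "0 < \<delta>" and z: "\<And>j. j \<in> J \<Longrightarrow> norm (z j) = 1"
    and M: "(2 * real M) ^ card J * (1 - \<delta>\<^sup>2 / 4) ^ M < 1" "0 < M"
    and inj: "inj_on (\<lambda>r. \<Sum>j\<in>J. repeat_mset (r j) (p j) + repeat_mset (M - r j) (q j)) (PiE J (\<lambda>_. {..M}))"
  shows "\<exists>\<phi>. unimodular \<phi> \<and> (\<forall>j\<in>J. norm (char_ext \<phi> (p j) - z j * char_ext \<phi> (q j)) < \<delta>)"
proof (rule ccontr)
  assume neg: "\<not> ?thesis"
  define Q where "Q = PiE J (\<lambda>_. {..M})"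
  define N where "N r = (\<Sum>j\<in>J. repeat_mset (r j) (p j) + repeat_mset (M - r j) (q j))" for r
  define c where "c r = (\<Prod>j\<in>J. of_nat (M choose r j) * z j ^ (M - r j))" for r
  have finQ: "finite Q" using J by (simp add: Q_def finite_PiE)
  obtain \<Gamma> :: "('e \<Rightarrow> nat) set" and \<Phi> where \<Gamma>: "finite \<Gamma>" "\<Gamma> \<noteq> {}" "\<And>a. unimodular (\<Phi> a)"
    and pars: "\<And>c. (\<Sum>a\<in>\<Gamma>. (norm (\<Sum>r\<in>Q. c r * char_ext (\<Phi> a) (N r)))\<^sup>2)
           = real (card \<Gamma>) * (\<Sum>r\<in>Q. (norm (c r))\<^sup>2)"
    using parseval_sampling[OF finQ inj[folded N_def Q_def]] by blast
  have "(\<Sum>r\<in>Q. c r * char_ext \<phi> (N r)) = (\<Prod>j\<in>J. (char_ext \<phi> (p j) + z j * char_ext \<phi> (q j)) ^ M)" for \<phi>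
  proof -
    have "(\<Prod>j\<in>J. (char_ext \<phi> (p j) + z j * char_ext \<phi> (q j)) ^ M)
        = (\<Prod>j\<in>J. \<Sum>k\<le>M. of_nat (M choose k) * char_ext \<phi> (p j) ^ k * (z j * char_ext \<phi> (q j)) ^ (M - k))"
      by (simp add: binomial_ring)
    also have "\<dots> = (\<Sum>r\<in>Q. \<Prod>j\<in>J. of_nat (M choose r j) * char_ext \<phi> (p j) ^ r j * (z j * char_ext \<phi> (q j)) ^ (M - r j))"
      unfolding Q_def by (rule prod_sum_PiE) (use J in auto)
    also have "\<dots> = (\<Sum>r\<in>Q. c r * char_ext \<phi> (N r))"
      by (simp add: c_def N_def char_ext_sum power_mult_distrib mult_ac flip: prod.distrib)
    finally show ?thesis by simp
  qed
  then have pars': "(\<Sum>a\<in>\<Gamma>. (norm (\<Prod>j\<in>J. (char_ext (\<Phi> a) (p j) + z j * char_ext (\<Phi> a) (q j)) ^ M))\<^sup>2)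
      = real (card \<Gamma>) * (\<Sum>r\<in>Q. (norm (c r))\<^sup>2)"
    using pars[of c] by simp
  have "(\<Sum>r\<in>Q. (norm (c r))\<^sup>2) = (\<Sum>r\<in>Q. \<Prod>j\<in>J. (real (M choose r j))\<^sup>2)"
    unfolding c_def using z by (intro sum.cong refl) (simp add: norm_mult norm_power prod_norm[symmetric] prod_power_distrib)
  also have "\<dots> = (\<Prod>j\<in>J. \<Sum>k\<le>M. (real (M choose k))\<^sup>2)"
    unfolding Q_def by (rule prod_sum_PiE[symmetric]) (use J in auto)
  also have "\<dots> = real ((2 * M) choose M) ^ card J"
    using choose_square_sum[of M, symmetric] by simp
  finally have coeffs: "(\<Sum>r\<in>Q. (norm (c r))\<^sup>2) = real ((2 * M) choose M) ^ card J" .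
  have "(norm (\<Prod>j\<in>J. (char_ext (\<Phi> a) (p j) + z j * char_ext (\<Phi> a) (q j)) ^ M))\<^sup>2
         \<le> (4 ^ M) ^ card J * (1 - \<delta>\<^sup>2 / 4) ^ M" for a
  proof -
    \<comment> \<open>The parallelogram law bounds every factor by 4, and the factor of a violated relation by \<open>4 - \<delta>\<^sup>2\<close>.\<close>
    define P where "P j = (norm (char_ext (\<Phi> a) (p j) + z j * char_ext (\<Phi> a) (q j)))\<^sup>2" for j
    have para: "P j = 4 - (norm (char_ext (\<Phi> a) (p j) - z j * char_ext (\<Phi> a) (q j)))\<^sup>2" if "j \<in> J" for j
    proof -
      have "norm (z j * char_ext (\<Phi> a) (q j)) = 1" "norm (char_ext (\<Phi> a) (p j)) = 1"
        using z[OF that] \<Gamma>(3) by (simp_all add: norm_mult norm_char_ext)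
      moreover have "(norm (x + y))\<^sup>2 = 2 * (norm x)\<^sup>2 + 2 * (norm y)\<^sup>2 - (norm (x - y))\<^sup>2" for x y :: complex
        by (simp add: power2_norm_eq_inner algebra_simps inner_commute)
      ultimately show ?thesis by (simp add: P_def)
    qed
    obtain i where i: "i \<in> J" "\<delta> \<le> norm (char_ext (\<Phi> a) (p i) - z i * char_ext (\<Phi> a) (q i))"
      using neg \<Gamma>(3)[of a] by (metis not_less)
    have Pi: "P i \<le> 4 * (1 - \<delta>\<^sup>2 / 4)"
      using para[OF i(1)] power_mono[OF i(2), of 2] \<delta> by simp
    moreover have "P j \<le> 4" if "j \<in> J" for j using para[OF that] by simp
    moreover have nn: "0 \<le> P j" for j by (simp add: P_def)
    moreover have "0 \<le> 4 * (1 - \<delta>\<^sup>2 / 4)" using nn Pi by (rule order_trans)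
    ultimately have "(\<Prod>j\<in>J. P j) \<le> (4 * (1 - \<delta>\<^sup>2 / 4)) * 4 ^ (card J - 1)"
      unfolding prod.remove[OF J i(1)]
      using prod_mono[of "J - {i}" P "\<lambda>_. 4"] J i(1)
      by (intro mult_mono prod_nonneg ballI) simp_all
    also have "\<dots> = 4 ^ card J * (1 - \<delta>\<^sup>2 / 4)"
      using i(1) J by (cases "card J") auto
    finally have "(\<Prod>j\<in>J. P j) ^ M \<le> (4 ^ card J * (1 - \<delta>\<^sup>2 / 4)) ^ M"
      by (intro power_mono prod_nonneg nn)
    moreover have "(norm (\<Prod>j\<in>J. (char_ext (\<Phi> a) (p j) + z j * char_ext (\<Phi> a) (q j)) ^ M))\<^sup>2 = (\<Prod>j\<in>J. P j) ^ M"
      unfolding P_def by (simp add: norm_power prod_norm[symmetric] prod_power_distrib mult.commute flip: power_mult)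
    ultimately show ?thesis by (simp add: power_mult_distrib mult.commute flip: power_mult)
  qed
  then have "(\<Sum>a\<in>\<Gamma>. (norm (\<Prod>j\<in>J. (char_ext (\<Phi> a) (p j) + z j * char_ext (\<Phi> a) (q j)) ^ M))\<^sup>2)
      \<le> real (card \<Gamma>) * ((4 ^ M) ^ card J * (1 - \<delta>\<^sup>2 / 4) ^ M)"
    by (intro sum_bounded_above)
  then have "real ((2 * M) choose M) ^ card J \<le> (4 ^ M) ^ card J * (1 - \<delta>\<^sup>2 / 4) ^ M"
    unfolding pars' coeffs using \<Gamma> by (simp add: card_gt_0_iff)
  moreover have "(4 ^ M / (2 * real M)) ^ card J \<le> real ((2 * M) choose M) ^ card J"
    using central_binomial_lower_bound[OF M(2)] by (intro power_mono) auto
  ultimately have "(4 ^ M / (2 * real M)) ^ card J \<le> (4 ^ M) ^ card J * (1 - \<delta>\<^sup>2 / 4) ^ M"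
    by linarith
  then have "1 \<le> (2 * real M) ^ card J * (1 - \<delta>\<^sup>2 / 4) ^ M"
    using M(2) by (simp add: power_divide field_simps)
  with M(1) show False by simp
qed

lemma kronecker_degree_exists:
  assumes "0 < \<delta>" "\<delta> < (2::real)"
  shows "\<exists>M>0. (2 * real M) ^ d * (1 - \<delta>\<^sup>2 / 4) ^ M < 1"
proof -
  define x where "x = 1 - \<delta>\<^sup>2 / 4"
  have "\<delta>\<^sup>2 < 2\<^sup>2" using assms by (intro power_strict_mono) auto
  then have x: "0 < x" "x < 1" using assms by (auto simp: x_def)
  have "(\<lambda>M. (2 * real M) ^ d * x ^ M) \<longlonglongrightarrow> 0"
  proof (cases "d = 0")
    case True
    then show ?thesis using x by (simp add: LIMSEQ_realpow_zero)
  next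
    case False
    define y where "y = root d x"
    have y: "0 < y" "y < 1" "y ^ d = x" using False x by (simp_all add: y_def)
    have "(\<lambda>M. of_nat M * y ^ M) \<longlonglongrightarrow> 0"
      using y by (intro powser_times_n_limit_0) simp
    then have "(\<lambda>M. 2 ^ d * (real M * y ^ M) ^ d) \<longlonglongrightarrow> 2 ^ d * 0 ^ d"
      by (intro tendsto_intros) simp
    moreover have "2 ^ d * (real M * y ^ M) ^ d = (2 * real M) ^ d * x ^ M" for M
      by (simp add: power_mult_distrib mult.commute flip: y(3) power_mult)
    ultimately show ?thesis using False by (simp add: power_0_left)
  qed
  then have "\<forall>\<^sub>F M in sequentially. (2 * real M) ^ d * x ^ M < 1"
    by (rule order_tendstoD) simp
  then have "\<forall>\<^sub>F M in sequentially. 0 < M \<and> (2 * real M) ^ d * x ^ M < 1"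
    using eventually_gt_at_top[of 0] by eventually_elim simp
  then show ?thesis
    unfolding x_def using eventually_happens'[OF sequentially_bot] by blast
qed

section \<open>Separating characters for independent sequences\<close>

text \<open>
  This is linear independence modulo \<open>U\<close> of the sequences \<open>\<gamma> i\<close> together with all constant
  sequences.  Integer coefficients are written as differences of natural numbers, which keeps the relation
  inside the free commutative monoid.
\<close>

definition independent_along :: "nat filter \<Rightarrow> 'i set \<Rightarrow> ('i \<Rightarrow> nat \<Rightarrow> 'e multiset) \<Rightarrow> bool" where
  "independent_along U I \<gamma> \<longleftrightarrow>
     (\<forall>J m m' C C'. finite J \<longrightarrow> J \<subseteq> I \<longrightarrow>
        (\<forall>\<^sub>F k in U. (\<Sum>i\<in>J. repeat_mset (m i) (\<gamma> i k)) + C = (\<Sum>i\<in>J. repeat_mset (m' i) (\<gamma> i k)) + C')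
        \<longrightarrow> (\<forall>i\<in>J. m i = m' i))"

lemma count_sum_repeat_singletons:
  assumes "finite F"
  shows "count (\<Sum>e\<in>F. repeat_mset (r e) {#e#}) x = (if x \<in> F then r x else 0)"
  using assms by (induction F) auto

text \<open>
  The requirements \<open>\<phi> e \<approx> z e\<close> and \<open>\<phi>(\<gamma> i k) \<approx> \<phi>(l i)\<close> are all of
  the form treated by the Kronecker theorem.  Its injectivity hypothesis fails at \<open>k\<close> only if one of
  finitely many nontrivial relations, with coefficients at most \<open>M\<close>, holds between the
  \<open>\<gamma> i k\<close> and constants; by independence \<open>U\<close>-almost all \<open>k\<close> avoid all of these.
\<close>

lemma independent_relations_solvable:
  fixes \<gamma> :: "'i \<Rightarrow> nat \<Rightarrow> 'e multiset"
  assumes U: "ultrafilter U" and ind: "independent_along U I \<gamma>"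
    and K: "finite K" "K \<subseteq> I" and F: "finite F" and z: "unimodular z" and \<delta>: "0 < \<delta>"
  shows "\<forall>\<^sub>F k in U. \<exists>\<phi>. unimodular \<phi> \<and> (\<forall>e\<in>F. norm (\<phi> e - z e) < \<delta>) \<and>
                       (\<forall>i\<in>K. norm (char_ext \<phi> (\<gamma> i k) - \<phi> (l i)) < \<delta>)"
proof -
  \<comment> \<open>The Kronecker degree estimate requires an error below 2, the diameter of the circle.\<close>
  define \<epsilon> where "\<epsilon> = min \<delta> 1"
  have \<epsilon>: "0 < \<epsilon>" "\<epsilon> < 2" "\<epsilon> \<le> \<delta>" using \<delta> by (auto simp: \<epsilon>_def)
  define J where "J = F <+> K"
  have finJ: "finite J" using F K by (simp add: J_def)
  obtain M where M: "0 < M" "(2 * real M) ^ card J * (1 - \<epsilon>\<^sup>2 / 4) ^ M < 1"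
    using kronecker_degree_exists[OF \<epsilon>(1,2)] by blast
  define p where "p k = case_sum (\<lambda>e. {#e#}) (\<lambda>i. \<gamma> i k)" for k
  define q :: "'e + 'i \<Rightarrow> 'e multiset" where "q = case_sum (\<lambda>e. {#}) (\<lambda>i. {#l i#})"
  define w where "w = case_sum z (\<lambda>_::'i. 1)"
  define Q where "Q = PiE J (\<lambda>_. {..M})"
  have finQ: "finite Q" using finJ by (simp add: Q_def finite_PiE)
  define N where "N k r = (\<Sum>j\<in>J. repeat_mset (r j) (p k j) + repeat_mset (M - r j) (q j))" for k r
  define D where "D r = (\<Sum>e\<in>F. repeat_mset (r (Inl e)) {#e#})" for r :: "'e + 'i \<Rightarrow> nat"
  define L where "L r = (\<Sum>i\<in>K. repeat_mset (M - r (Inr i)) {#l i#})" for r :: "'e + 'i \<Rightarrow> nat"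
  have N: "N k r = (\<Sum>i\<in>K. repeat_mset (r (Inr i)) (\<gamma> i k)) + (D r + L r)" for k r
    unfolding N_def J_def D_def L_def p_def q_def
    using F K by (simp add: sum.Plus sum.distrib add_ac)
  have "\<forall>\<^sub>F k in U. r \<noteq> s \<longrightarrow> N k r \<noteq> N k s" if rs: "r \<in> Q" "s \<in> Q" for r s
  proof (rule ccontr)
    assume "\<not> ?thesis"
    then have ev: "\<forall>\<^sub>F k in U. N k r = N k s" and ne: "r \<noteq> s"
      using ultrafilter_not_eventually[OF U] by (auto elim: eventually_mono)
    then have "\<forall>i\<in>K. r (Inr i) = s (Inr i)"
      using ind[unfolded independent_along_def, rule_format, OF K,
          where m = "\<lambda>i. r (Inr i)" and m' = "\<lambda>i. s (Inr i)"] unfolding N by blast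
    moreover from this have "L r = L s" by (simp add: L_def)
    moreover obtain k where "N k r = N k s"
      using ev U eventually_happens' unfolding ultrafilter_def by blast
    ultimately have "D r = D s" by (simp add: N)
    then have "\<forall>e\<in>F. r (Inl e) = s (Inl e)"
      using count_sum_repeat_singletons[OF F] unfolding D_def by metis
    with \<open>\<forall>i\<in>K. _\<close> have "r j = s j" if "j \<in> J" for j
      using that by (auto simp: J_def)
    then have "r = s" using rs unfolding Q_def by (rule PiE_ext[rotated 2])
    with ne show False by simp
  qed
  then have "\<forall>\<^sub>F k in U. \<forall>r\<in>Q. \<forall>s\<in>Q. r \<noteq> s \<longrightarrow> N k r \<noteq> N k s"
    by (intro eventually_ball_finite finQ ballI)
  then show ?thesis
  proof eventually_elim
    case (elim k)
    then have inj: "inj_on (N k) Q" by (auto simp: inj_on_def)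
    have "\<exists>\<phi>. unimodular \<phi> \<and> (\<forall>j\<in>J. norm (char_ext \<phi> (p k j) - w j * char_ext \<phi> (q j)) < \<epsilon>)"
      using inj z unfolding N_def Q_def
      by (intro kronecker_multisets[OF finJ \<epsilon>(1) _ M(2,1)]) (auto simp: w_def J_def unimodular_def)
    then obtain \<phi> where \<phi>: "unimodular \<phi>" "\<And>j. j \<in> J \<Longrightarrow> norm (char_ext \<phi> (p k j) - w j * char_ext \<phi> (q j)) < \<epsilon>"
      by blast
    have "norm (\<phi> e - z e) < \<delta>" if "e \<in> F" for e
      using \<phi>(2)[of "Inl e"] that \<epsilon>(3) by (simp add: J_def p_def q_def w_def InlI)
    moreover have "norm (char_ext \<phi> (\<gamma> i k) - \<phi> (l i)) < \<delta>" if "i \<in> K" for i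
      using \<phi>(2)[of "Inr i"] that \<epsilon>(3) by (simp add: J_def p_def q_def w_def InrI)
    ultimately show ?case using \<phi>(1) by blast
  qed
qed

text \<open>
  This turns the open set of characters that satisfy the earlier conditions into finitely many values to
  be kept approximately, which is the form in which independence can be used.
\<close>

lemma open_fun_finite_coordinates:
  fixes S :: "('e \<Rightarrow> complex) set"
  assumes "open S" "\<phi> \<in> S"
  shows "\<exists>F \<delta>. finite F \<and> 0 < \<delta> \<and> (\<forall>\<psi>. (\<forall>e\<in>F. norm (\<psi> e - \<phi> e) < \<delta>) \<longrightarrow> \<psi> \<in> S)"
proof -
  have "openin (product_topology (\<lambda>_. euclidean) UNIV) S"
    using assms(1) by (simp add: euclidean_product_topology)
  from product_topology_open_contains_basis[OF this assms(2)]
  obtain X where X: "\<phi> \<in> (\<Pi>\<^sub>E i\<in>UNIV. X i)" "\<And>i. open (X i)" "finite {i. X i \<noteq> UNIV}" "(\<Pi>\<^sub>E i\<in>UNIV. X i) \<subseteq> S"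
    by auto
  define F where "F = {i. X i \<noteq> UNIV}"
  have "\<exists>d>0. ball (\<phi> e) d \<subseteq> X e" for e
    using X(1) X(2)[of e] open_contains_ball by (metis PiE_iff UNIV_I)
  then obtain d where d: "\<And>e. 0 < d e" "\<And>e. ball (\<phi> e) (d e) \<subseteq> X e" by metis
  define \<delta> where "\<delta> = Min (insert 1 (d ` F))"
  have "finite F" using X(3) by (simp add: F_def)
  then have "0 < \<delta>" "\<And>e. e \<in> F \<Longrightarrow> \<delta> \<le> d e" using d(1) by (auto simp: \<delta>_def)
  moreover have "\<psi> \<in> S" if "\<forall>e\<in>F. norm (\<psi> e - \<phi> e) < \<delta>" for \<psi>
  proof -
    have "\<psi> e \<in> X e" for e
    proof (cases "e \<in> F")
      case True
      then have "\<psi> e \<in> ball (\<phi> e) (d e)"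
        using that calculation(2)[OF True] by (force simp: dist_norm norm_minus_commute)
      then show ?thesis using d(2) by blast
    qed (simp add: F_def)
    then show ?thesis using X(4) by (auto simp: PiE_iff)
  qed
  ultimately show ?thesis using \<open>finite F\<close> by blast
qed

lemma continuous_on_char_ext: "continuous_on UNIV (\<lambda>\<phi>. char_ext \<phi> M)"
  by (induction M) (auto intro!: continuous_intros)

lemma tendsto_char_ext:
  assumes "\<And>e. ((\<lambda>n. z n e) \<longlongrightarrow> \<phi> e) U"
  shows "((\<lambda>n. char_ext (z n) M) \<longlongrightarrow> char_ext \<phi> M) U"
  by (induction M) (auto intro!: tendsto_intros assms)

text \<open>
  One generator occurs with different multiplicities in \<open>d\<close> and \<open>d'\<close>; a suitable
  value there, and 1 at all other generators, makes the ratio of the two character values \<open>-1\<close>.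
\<close>

lemma unimodular_opposite_values:
  assumes "d \<noteq> d'"
  shows "\<exists>\<phi>. unimodular \<phi> \<and> char_ext \<phi> d = - char_ext \<phi> d'"
proof -
  obtain e where e: "count d e \<noteq> count d' e" using assms by (auto simp: multiset_eq_iff)
  define t where "t = pi / (real (count d e) - real (count d' e))"
  define \<phi> where "\<phi> x = (if x = e then cis t else 1)" for x
  have val: "char_ext \<phi> M = cis (real (count M e) * t)" for M
    by (induction M) (auto simp: \<phi>_def cis_mult ring_distribs)
  have "real (count d e) * t = real (count d' e) * t + pi"
    using e by (simp add: t_def field_simps)
  then have "char_ext \<phi> d = - char_ext \<phi> d'"
    unfolding val by (simp flip: cis_mult)
  moreover have "unimodular \<phi>" by (simp add: unimodular_def \<phi>_def)
  ultimately show ?thesis by blast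
qed

text \<open>
  For a finite set \<open>K\<close> of indices, \<open>S K\<close> is the open set of functions that keep \<open>d\<close> and \<open>d'\<close>
  apart and, for \<open>a < b\<close> in \<open>K\<close>, satisfy the first few relations at the index \<open>b\<close> up to
  \<open>1 / (a + 1)\<close>.  The number of relations and the precision depend on \<open>a\<close> and not on \<open>b\<close>: a
  given element of \<open>S K\<close> can be improved to satisfy a fixed finite set of relations with fixed precision at
  \<open>U\<close>-almost every new index \<open>b\<close>, and the diagonal property supplies a set \<open>A\<close> in \<open>U\<close>
  all of whose finite subsets can be treated in this way.  A limit along \<open>U\<close> of characters for the
  initial segments of \<open>A\<close> satisfies the weak form of all the conditions.
\<close>

lemma separating_character_exists:
  fixes \<gamma> :: "'i \<Rightarrow> nat \<Rightarrow> 'e multiset"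
  assumes sel: "selective_ultrafilter U" and ind: "independent_along U I \<gamma>"
    and I: "countable I" and d: "d \<noteq> d'"
  shows "\<exists>\<phi>. unimodular \<phi> \<and> char_ext \<phi> d \<noteq> char_ext \<phi> d' \<and>
             (\<forall>i\<in>I. ((\<lambda>k. char_ext \<phi> (\<gamma> i k)) \<longlongrightarrow> \<phi> (l i)) U)"
proof -
  have free: "free_ultrafilter U" and U: "ultrafilter U"
    using sel by (auto simp: selective_ultrafilter_def free_ultrafilter_def)
  define H where "H n = {i \<in> I. to_nat_on I i \<le> n}" for n
  have finH: "finite (H n)" for n
  proof (rule finite_imageD)
    show "finite (to_nat_on I ` H n)" by (rule finite_subset[of _ "{..n}"]) (auto simp: H_def)
    show "inj_on (to_nat_on I) (H n)"
      using inj_on_to_nat_on[OF I] by (rule inj_on_subset) (auto simp: H_def)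
  qed
  have HI: "H n \<subseteq> I" and Hmono: "m \<le> n \<Longrightarrow> H m \<subseteq> H n" for m n by (auto simp: H_def)
  define R where "R a b \<phi> \<longleftrightarrow> (\<forall>i\<in>H a. norm (char_ext \<phi> (\<gamma> i b) - \<phi> (l i)) < 1 / (real a + 1))" for a b \<phi>
  have Rmono: "R a' b \<phi>" if "R a b \<phi>" "a' \<le> a" for a a' b \<phi>
  proof -
    have "1 / (real a + 1) \<le> 1 / (real a' + 1)" using that(2) by (simp add: frac_le)
    then show ?thesis using that Hmono[OF that(2)] unfolding R_def by fastforce
  qed
  define S where "S K = {\<phi>. 1 < norm (char_ext \<phi> d - char_ext \<phi> d') \<and> (\<forall>a\<in>K. \<forall>b\<in>K. a < b \<longrightarrow> R a b \<phi>)}" for K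
  have openS: "open (S K)" if "finite K" for K
  proof -
    have S_eq: "S K = {\<phi>. 1 < norm (char_ext \<phi> d - char_ext \<phi> d')} \<inter>
      (\<Inter>a\<in>K. \<Inter>b\<in>{b\<in>K. a < b}. \<Inter>i\<in>H a. {\<phi>. norm (char_ext \<phi> (\<gamma> i b) - \<phi> (l i)) < 1 / (real a + 1)})"
      by (auto simp: S_def R_def)
    have c: "continuous_on UNIV (\<lambda>\<phi>. char_ext \<phi> M - char_ext \<phi> M')" for M M' :: "'e multiset"
      by (intro continuous_intros continuous_on_char_ext)
    have c': "continuous_on UNIV (\<lambda>\<phi>. char_ext \<phi> M - \<phi> x)" for M :: "'e multiset" and x
      using c[of M "{#x#}"] by simp
    show ?thesis unfolding S_eq using that finH
      by (intro open_Int open_INT ballI open_Collect_less continuous_intros c c') auto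
  qed
  define P where "P a = {b. \<forall>K\<in>Pow {..a}. (\<exists>\<phi>. unimodular \<phi> \<and> \<phi> \<in> S K) \<longrightarrow> (\<exists>\<phi>. unimodular \<phi> \<and> \<phi> \<in> S K \<and> R a b \<phi>)}" for a
  have P: "\<forall>\<^sub>F b in U. b \<in> P a" for a
  proof -
    have "\<forall>\<^sub>F b in U. (\<exists>\<phi>. unimodular \<phi> \<and> \<phi> \<in> S K) \<longrightarrow> (\<exists>\<phi>. unimodular \<phi> \<and> \<phi> \<in> S K \<and> R a b \<phi>)"
      if K: "K \<in> Pow {..a}" for K
    proof (cases "\<exists>\<phi>. unimodular \<phi> \<and> \<phi> \<in> S K")
      case True
      then obtain z where z: "unimodular z" "z \<in> S K" by blast
      have "finite K" using K by (auto intro: finite_subset)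
      from open_fun_finite_coordinates[OF openS[OF this] z(2)] obtain F \<delta>
        where F: "finite F" "0 < \<delta>" "\<And>\<psi>. (\<forall>e\<in>F. norm (\<psi> e - z e) < \<delta>) \<Longrightarrow> \<psi> \<in> S K" by blast
      define \<epsilon> where "\<epsilon> = min \<delta> (1 / (real a + 1))"
      have \<epsilon>: "0 < \<epsilon>" "\<epsilon> \<le> \<delta>" "\<epsilon> \<le> 1 / (real a + 1)" using F(2) by (auto simp: \<epsilon>_def)
      from independent_relations_solvable[OF U ind finH HI F(1) z(1) \<epsilon>(1), of a l]
      show ?thesis
      proof eventually_elim
        case (elim b)
        then obtain \<phi> where \<phi>: "unimodular \<phi>" "\<forall>e\<in>F. norm (\<phi> e - z e) < \<epsilon>"
          "\<forall>i\<in>H a. norm (char_ext \<phi> (\<gamma> i b) - \<phi> (l i)) < \<epsilon>" by blast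
        have "\<phi> \<in> S K" using \<phi>(2) \<epsilon>(2) by (intro F(3)) force
        moreover have "R a b \<phi>" using \<phi>(3) \<epsilon>(3) unfolding R_def by force
        ultimately show ?case using \<phi>(1) by blast
      qed
    next
      case False
      then show ?thesis by (intro always_eventually) blast
    qed
    then have "\<forall>\<^sub>F b in U. \<forall>K\<in>Pow {..a}. (\<exists>\<phi>. unimodular \<phi> \<and> \<phi> \<in> S K) \<longrightarrow> (\<exists>\<phi>. unimodular \<phi> \<and> \<phi> \<in> S K \<and> R a b \<phi>)"
      by (intro eventually_ball_finite) auto
    then show ?thesis by (simp add: P_def)
  qed
  obtain A where A: "\<forall>\<^sub>F k in U. k \<in> A" "\<And>a b. a \<in> A \<Longrightarrow> b \<in> A \<Longrightarrow> a < b \<Longrightarrow> b \<in> P a"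
    using selective_diagonal[of U P, OF sel P] by blast
  have approx: "\<exists>\<phi>. unimodular \<phi> \<and> \<phi> \<in> S K" if "finite K" "K \<subseteq> A" for K
    using that
  proof (induction K rule: finite_linorder_max_induct)
    case empty
    obtain \<phi> where \<phi>: "unimodular \<phi>" "char_ext \<phi> d = - char_ext \<phi> d'"
      using unimodular_opposite_values[OF d] by blast
    then have "char_ext \<phi> d - char_ext \<phi> d' = - 2 * char_ext \<phi> d'" by simp
    then have "norm (char_ext \<phi> d - char_ext \<phi> d') = 2"
      unfolding \<open>char_ext \<phi> d - char_ext \<phi> d' = - 2 * char_ext \<phi> d'\<close> norm_mult norm_char_ext[OF \<phi>(1)] by simp
    then show ?case using \<phi>(1) by (auto simp: S_def)
  next
    case (insert b K)
    then obtain z where z: "unimodular z" "z \<in> S K" by blast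
    show ?case
    proof (cases "K = {}")
      case True
      then show ?thesis using z by (auto simp: S_def)
    next
      case False
      define a where "a = Max K"
      have a: "a \<in> K" "K \<subseteq> {..a}" using False insert.hyps by (auto simp: a_def)
      then have "b \<in> P a" using insert by (intro A(2)) auto
      then obtain \<phi> where \<phi>: "unimodular \<phi>" "\<phi> \<in> S K" "R a b \<phi>"
        using z a(2) unfolding P_def by blast
      have "\<phi> \<in> S (insert b K)"
        using \<phi>(2) Rmono[OF \<phi>(3)] a(2) insert.hyps(2) unfolding S_def
        by (auto dest: less_asym)
      then show ?thesis using \<phi>(1) by blast
    qed
  qed
  have "\<exists>\<phi>. unimodular \<phi> \<and> \<phi> \<in> S (A \<inter> {..n})" for n
    by (rule approx) auto
  then obtain z where z: "\<And>n. unimodular (z n)" "\<And>n. z n \<in> S (A \<inter> {..n})" by metis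
  have "\<exists>c\<in>sphere 0 1. ((\<lambda>n. z n e) \<longlongrightarrow> c) U" for e
    by (rule ultrafilter_tendsto_compact[OF U]) (use z(1) in \<open>auto simp: unimodular_def\<close>)
  then obtain \<phi> where \<phi>: "\<And>e. \<phi> e \<in> sphere 0 1" "\<And>e. ((\<lambda>n. z n e) \<longlongrightarrow> \<phi> e) U" by metis
  have bot: "U \<noteq> bot" using U by (simp add: ultrafilter_def)
  have "1 \<le> norm (char_ext \<phi> d - char_ext \<phi> d')"
    by (rule tendsto_lowerbound[OF tendsto_norm[OF tendsto_diff[OF tendsto_char_ext[OF \<phi>(2)] tendsto_char_ext[OF \<phi>(2)]]] _ bot])
       (use z(2) in \<open>auto simp: S_def intro!: always_eventually less_imp_le\<close>)
  then have "char_ext \<phi> d \<noteq> char_ext \<phi> d'" by auto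
  moreover have "((\<lambda>k. char_ext \<phi> (\<gamma> i k)) \<longlongrightarrow> \<phi> (l i)) U" if i: "i \<in> I" for i
  proof (rule tendstoI)
    fix \<epsilon> :: real assume "0 < \<epsilon>"
    have bound: "norm (char_ext \<phi> (\<gamma> i b) - \<phi> (l i)) \<le> 1 / (real a + 1)"
      if ab: "a \<in> A" "b \<in> A" "a < b" "i \<in> H a" for a b
    proof (rule tendsto_upperbound[OF tendsto_norm[OF tendsto_diff[OF tendsto_char_ext[OF \<phi>(2)] \<phi>(2)]] _ bot])
      have "\<forall>\<^sub>F n in U. n \<notin> {..<b}"
        using free by (rule free_ultrafilter_avoids_finite) simp
      then show "\<forall>\<^sub>F n in U. norm (char_ext (z n) (\<gamma> i b) - z n (l i)) \<le> 1 / (real a + 1)"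
      proof eventually_elim
        case (elim n)
        then have "R a b (z n)" using z(2)[of n] ab by (auto simp: S_def)
        then show ?case using ab(4) by (auto simp: R_def less_imp_le)
      qed
    qed
    obtain n0 where n0: "1 / (real n0 + 1) < \<epsilon>"
      by (rule nat_approx_posE[OF \<open>0 < \<epsilon>\<close>]) (simp add: add.commute)
    have "\<forall>\<^sub>F a in U. a \<notin> {..max n0 (to_nat_on I i)}"
      using free by (rule free_ultrafilter_avoids_finite) simp
    with A(1) have "\<forall>\<^sub>F a in U. a \<in> A \<and> a \<notin> {..max n0 (to_nat_on I i)}" by (rule eventually_conj)
    then obtain a where a: "a \<in> A" "n0 < a" "to_nat_on I i < a"
      using eventually_happens'[OF bot, of "\<lambda>a. a \<in> A \<and> a \<notin> {..max n0 (to_nat_on I i)}"] by auto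
    have "1 / (real a + 1) \<le> 1 / (real n0 + 1)" using a(2) by (simp add: frac_le)
    then have small: "1 / (real a + 1) < \<epsilon>" using n0 by linarith
    have "\<forall>\<^sub>F b in U. b \<notin> {..a}"
      using free by (rule free_ultrafilter_avoids_finite) simp
    with A(1) show "\<forall>\<^sub>F b in U. dist (char_ext \<phi> (\<gamma> i b)) (\<phi> (l i)) < \<epsilon>"
    proof eventually_elim
      case (elim b)
      then show ?case using bound[of a b] small a i by (auto simp: H_def dist_norm)
    qed
  qed
  moreover have "unimodular \<phi>" using \<phi>(1) by (simp add: unimodular_def)
  ultimately show ?thesis by blast
qed

section \<open>Independent reparametrizations of continuum many sequences\<close>

text \<open>
  The initial segments of \<open>x\<close>, regarded as a branch through the binary tree.  This is the usual
  almost disjoint family: it provides continuum many reparametrizations of a sequence, any two of which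
  agree only finitely often.
\<close>

definition branch_code :: "nat set \<Rightarrow> nat \<Rightarrow> nat" where
  "branch_code x k = set_encode (x \<inter> {..<k})"

lemma branch_code_eventually_neq:
  assumes "free_ultrafilter U" "x \<noteq> y"
  shows "\<forall>\<^sub>F k in U. branch_code x k \<noteq> branch_code y k"
proof -
  obtain n where n: "(n \<in> x) \<noteq> (n \<in> y)" using assms(2) by blast
  have "\<forall>\<^sub>F k in U. k \<notin> {..n}"
    using assms(1) by (rule free_ultrafilter_avoids_finite) simp
  then show ?thesis
  proof eventually_elim
    case (elim k)
    then have "n \<in> {..<k}" by simp
    then have "x \<inter> {..<k} \<noteq> y \<inter> {..<k}" using n by blast
    then show ?case unfolding branch_code_def by (subst set_encode_eq) auto
  qed
qed

text \<open>
  Two solutions \<open>x\<close> and \<open>x0\<close> satisfy the relation with different constants.  Subtracting the two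
  relations removes \<open>S\<close> and \<open>S'\<close> and shows that the difference between the sequences for \<open>x\<close>
  and \<open>x0\<close> is constant modulo \<open>U\<close>.  This constant is already visible at a single index, so for
  fixed \<open>x0\<close> it takes countably many values, and it determines \<open>x\<close>.
\<close>

lemma countable_dependent_branches:
  fixes a S S' :: "nat \<Rightarrow> 'e multiset"
  assumes free: "free_ultrafilter U" and a: "inj a" and n: "n \<noteq> n'"
  shows "countable {x. \<exists>C C'. \<forall>\<^sub>F k in U. repeat_mset n (a (branch_code x k)) + (S k + C)
                                        = repeat_mset n' (a (branch_code x k)) + (S' k + C')}"
    (is "countable ?B")
proof (cases "?B = {}")
  case True
  then show ?thesis by simp
next
  case False
  define B where "B = ?B"
  have U: "ultrafilter U" using free by (simp add: free_ultrafilter_def)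
  define g where "g x k = a (branch_code x k)" for x k
  obtain x0 C0 C0' where x0: "\<forall>\<^sub>F k in U. repeat_mset n (g x0 k) + (S k + C0) = repeat_mset n' (g x0 k) + (S' k + C0')"
    using False unfolding g_def by blast
  define G where "G x k = (\<lambda>e. (int n - int n') * (int (count (g x k) e) - int (count (g x0 k) e)))" for x k
  have "\<exists>D. \<forall>\<^sub>F k in U. G x k = D" if xB: "x \<in> B" for x
  proof -
    obtain C C' where x: "\<forall>\<^sub>F k in U. repeat_mset n (g x k) + (S k + C) = repeat_mset n' (g x k) + (S' k + C')"
      using xB unfolding B_def g_def by blast
    have "\<forall>\<^sub>F k in U. G x k = (\<lambda>e. int (count C' e) - int (count C e) - int (count C0' e) + int (count C0 e))"
      using x x0
    proof eventually_elim
      case (elim k)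
      show ?case
      proof
        fix e
        have "int n * int (count (g x k) e) + (int (count (S k) e) + int (count C e))
            = int n' * int (count (g x k) e) + (int (count (S' k) e) + int (count C' e))"
          using arg_cong[OF elim(1), of "\<lambda>M. int (count M e)"] by simp
        moreover have "int n * int (count (g x0 k) e) + (int (count (S k) e) + int (count C0 e))
            = int n' * int (count (g x0 k) e) + (int (count (S' k) e) + int (count C0' e))"
          using arg_cong[OF elim(2), of "\<lambda>M. int (count M e)"] by simp
        ultimately show "G x k e = int (count C' e) - int (count C e) - int (count C0' e) + int (count C0 e)"
          unfolding G_def by (simp add: algebra_simps)
      qed
    qed
    then show ?thesis by blast
  qed
  then obtain D where D: "\<And>x. x \<in> B \<Longrightarrow> \<forall>\<^sub>F k in U. G x k = D x"
    using bchoice[of B "\<lambda>x D. \<forall>\<^sub>F k in U. G x k = D"] by blast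
  have "\<exists>k. G x k = D x" if "x \<in> B" for x
    using eventually_happens'[OF _ D[OF that]] U unfolding ultrafilter_def by blast
  then obtain \<kappa> where \<kappa>: "\<And>x. x \<in> B \<Longrightarrow> G x (\<kappa> x) = D x" by metis
  have "inj_on (\<lambda>x. (branch_code x (\<kappa> x), branch_code x0 (\<kappa> x))) B"
  proof (rule inj_onI)
    fix x y assume xy: "x \<in> B" "y \<in> B"
      and eq: "(branch_code x (\<kappa> x), branch_code x0 (\<kappa> x)) = (branch_code y (\<kappa> y), branch_code x0 (\<kappa> y))"
    have "D x = D y" using eq \<kappa>[OF xy(1)] \<kappa>[OF xy(2)] by (simp add: G_def g_def)
    with D[OF xy(1)] D[OF xy(2)] have "\<forall>\<^sub>F k in U. G x k = G y k" by (auto elim: eventually_elim2)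
    then have "\<forall>\<^sub>F k in U. branch_code x k = branch_code y k"
    proof eventually_elim
      case (elim k)
      have "count (g x k) e = count (g y k) e" for e
        using fun_cong[OF elim, of e] n by (simp add: G_def)
      then have "g x k = g y k" by (rule multiset_eqI)
      then show ?case using a by (simp add: g_def inj_eq)
    qed
    then show "x = y"
      using branch_code_eventually_neq[OF free, of x y] ultrafilter_not_eventually[OF U] by blast
  qed
  then show ?thesis unfolding B_def[symmetric] by (rule countableI')
qed

lemma card_of_Fpow_infinite:
  includes cardinal_syntax
  assumes B: "infinite B"
  shows "|Fpow B| \<le>o |B|"
proof -
  define L where "L n = {xs. set xs \<subseteq> B \<and> length xs = n}" for n
  have L: "|L n| \<le>o |B|" for n
  proof (induction n)
    case 0
    have "L 0 = {[]}" by (auto simp: L_def)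
    moreover have "B \<noteq> {}" using B by auto
    ultimately show ?case using card_of_singl_ordLeq by simp
  next
    case (Suc n)
    have "L (Suc n) = (\<lambda>(x, xs). x # xs) ` (B \<times> L n)"
      by (force simp: L_def length_Suc_conv)
    then have "|L (Suc n)| \<le>o |B \<times> L n|" by (simp add: card_of_image)
    moreover have "|B \<times> L n| \<le>o |B|"
      using B Suc card_of_mono1[OF order_refl] by (intro card_of_Sigma_ordLeq_infinite) auto
    ultimately show ?case by (rule ordLeq_transitive)
  qed
  have "Fpow B \<subseteq> set ` (\<Union>n\<in>(UNIV::nat set). L n)"
  proof
    fix S assume "S \<in> Fpow B"
    then obtain xs where "set xs = S" "S \<subseteq> B" using finite_list unfolding Fpow_def by blast
    then show "S \<in> set ` (\<Union>n\<in>UNIV. L n)" by (auto simp: L_def)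
  qed
  then have "|Fpow B| \<le>o |set ` (\<Union>n\<in>(UNIV::nat set). L n)|" by (rule card_of_mono1)
  also have "|set ` (\<Union>n\<in>(UNIV::nat set). L n)| \<le>o |\<Union>n\<in>(UNIV::nat set). L n|" by (rule card_of_image)
  also have "|\<Union>n\<in>(UNIV::nat set). L n| \<le>o |B|"
    using B L infinite_iff_card_of_nat by (intro card_of_UNION_ordLeq_infinite) auto
  finally show ?thesis .
qed

lemma finite_set_has_greatest_of_linear_order:
  assumes "linear_order_on UNIV r" "finite J" "J \<noteq> {}"
  shows "\<exists>i\<in>J. \<forall>j\<in>J. (j, i) \<in> r"
  using assms(2,3)
proof (induction J rule: finite_ne_induct)
  case (singleton x)
  then show ?case using assms(1) by (auto simp: order_on_defs refl_on_def)
next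
  case (insert x F)
  then obtain i where i: "i \<in> F" "\<And>j. j \<in> F \<Longrightarrow> (j, i) \<in> r" by blast
  have r: "trans r" "total_on UNIV r" "\<And>y. (y, y) \<in> r"
    using assms(1) by (auto simp: order_on_defs refl_on_def)
  show ?case
  proof (cases "(x, i) \<in> r")
    case True
    then show ?thesis using i by blast
  next
    case False
    then have "(i, x) \<in> r" using r(2,3) by (cases "i = x") (auto simp: total_on_def)
    then have "(j, x) \<in> r" if "j \<in> insert x F" for j
      using that r(3) i(2) transD[OF r(1)] by blast
    then show ?thesis by blast
  qed
qed

text \<open>
  The index set is well-ordered with the order type of its cardinality, so every \<open>i\<close> has fewer than
  continuum many predecessors.  A branch \<open>x i\<close> is unsuitable if its sequence satisfies a relation with
  those of finitely many predecessors.  For each finite set of predecessors the unsuitable branches are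
  countably many, so fewer than continuum many branches are unsuitable altogether.  A nontrivial
  relation between the chosen sequences would contradict the choice at its greatest index.
\<close>

lemma independent_branches_exist:
  includes cardinal_syntax
  fixes A :: "'i \<Rightarrow> nat \<Rightarrow> 'e multiset"
  assumes free: "free_ultrafilter U" and inj: "\<And>i. i \<in> I \<Longrightarrow> inj (A i)"
    and card: "|UNIV :: 'i set| \<le>o |UNIV :: nat set set|"
  shows "\<exists>x. independent_along U I (\<lambda>i k. A i (branch_code (x i) k))"
proof -
  define r where "r = |UNIV :: 'i set|"
  have wo: "well_order_on UNIV r" using card_of_well_order_on by (auto simp: r_def)
  define Y where "Y f m J k = (\<Sum>j\<in>J. repeat_mset (m j) (A j (branch_code (f j) k)))"
    for f :: "'i \<Rightarrow> nat set" and m J k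
  define dep where "dep f i x J m m' n n' C C' \<longleftrightarrow>
      (\<forall>\<^sub>F k in U. repeat_mset n (A i (branch_code x k)) + (Y f m J k + C)
                = repeat_mset n' (A i (branch_code x k)) + (Y f m' J k + C'))"
    for f :: "'i \<Rightarrow> nat set" and i x J m m' n n' C C'
  define good where "good f i x \<longleftrightarrow> (i \<in> I \<longrightarrow>
      \<not> (\<exists>J m m' n n' C C'. finite J \<and> J \<subseteq> underS r i \<and> n \<noteq> n' \<and> dep f i x J m m' n n' C C'))"
    for f :: "'i \<Rightarrow> nat set" and i x
  have "\<exists>x. \<forall>i. good x i (x i)"
  proof (rule dependent_wf_choice)
    show "wf (r - Id)" using wo by (simp add: well_order_on_def)
  next
    fix f g :: "'i \<Rightarrow> nat set" and i x
    assume fg: "\<And>z. (z, i) \<in> r - Id \<Longrightarrow> f z = g z"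
    have "Y f m J k = Y g m J k" if "J \<subseteq> underS r i" for m J k
      unfolding Y_def using that fg by (intro sum.cong refl) (auto simp: underS_def)
    then show "good f i x = good g i x" unfolding good_def dep_def by auto
  next
    fix i and f :: "'i \<Rightarrow> nat set"
    show "\<exists>x. good f i x"
    proof (rule ccontr)
      assume none: "\<nexists>x. good f i x"
      then have i: "i \<in> I" by (auto simp: good_def)
      define E where "E J m m' n n' = {x. \<exists>C C'. dep f i x J m m' n n' C C'}" for J m m' n n'
      define T where "T J = (\<Union>m\<in>PiE J (\<lambda>_. UNIV). \<Union>m'\<in>PiE J (\<lambda>_. UNIV). \<Union>n. \<Union>n'\<in>-{n}. E J m m' n n')" for J
      define V where "V = (\<Union>J\<in>Fpow (underS r i). T J)"
      have E: "countable (E J m m' n n')" if "n \<noteq> n'" for J m m' n n'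
        unfolding E_def dep_def using countable_dependent_branches[OF free inj[OF i] that] .
      have T: "countable (T J)" if "finite J" for J
        unfolding T_def using that E by (intro countable_UN countable_PiE) auto
      have "x \<in> V" for x
      proof -
        have "\<not> good f i x" using none by blast
        then obtain J m m' n n' C C' where J: "finite J" "J \<subseteq> underS r i" "n \<noteq> n'" "dep f i x J m m' n n' C C'"
          unfolding good_def not_imp not_not by (elim conjE exE) (rule that)
        have "Y f (restrict m J) J k = Y f m J k" for m k by (simp add: Y_def)
        then have "dep f i x J (restrict m J) (restrict m' J) n n' C C'"
          using J(4) by (simp add: dep_def)
        then have "x \<in> E J (restrict m J) (restrict m' J) n n'" by (auto simp: E_def)
        then have "x \<in> T J"
          unfolding T_def using J(3) by (intro UN_I[where a = "restrict m J"] UN_I[where a = "restrict m' J"]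
              UN_I[where a = n] UN_I[where a = n']) auto
        then show ?thesis using J by (auto simp: V_def Fpow_def)
      qed
      then have V: "V = UNIV" by blast
      \<comment> \<open>The sum with the natural numbers makes the bound infinite even if there are finitely many predecessors.\<close>
      define W where "W = underS r i <+> (UNIV :: nat set)"
      have infW: "infinite W" by (simp add: W_def)
      have infN: "infinite (UNIV :: nat set set)" by (simp add: Finite_Set.finite_set)
      have "|underS r i| <o r"
        unfolding r_def by (rule card_of_underS[OF card_of_Card_order]) (simp add: Field_card_of)
      then have "|underS r i| <o |UNIV :: nat set set|"
        using card unfolding r_def by (rule ordLess_ordLeq_trans)
      moreover have "|UNIV :: nat set| <o |UNIV :: nat set set|"
        using card_of_Pow[of "UNIV :: nat set"] by simp
      ultimately have W: "|W| <o |UNIV :: nat set set|"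
        unfolding W_def using infN by (intro card_of_Plus_ordLess_infinite)
      have "|Fpow (underS r i)| \<le>o |Fpow W|"
      proof (rule card_of_ordLeqI)
        show "inj_on ((`) Inl) (Fpow (underS r i))" by (auto simp: inj_on_def inj_image_eq_iff)
        show "\<And>S. S \<in> Fpow (underS r i) \<Longrightarrow> Inl ` S \<in> Fpow W" by (auto simp: Fpow_def W_def)
      qed
      then have "|Fpow (underS r i)| \<le>o |W|"
        using card_of_Fpow_infinite[OF infW] ordLeq_transitive by blast
      moreover have "|T J| \<le>o |W|" if "J \<in> Fpow (underS r i)" for J
      proof -
        have "|T J| \<le>o |UNIV :: nat set|"
          using T[of J] that unfolding Fpow_def countable_def card_of_ordLeq[symmetric] by auto
        then show ?thesis using infW infinite_iff_card_of_nat ordLeq_transitive by blast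
      qed
      ultimately have "|V| \<le>o |W|"
        unfolding V_def using infW by (intro card_of_UNION_ordLeq_infinite) auto
      with W show False unfolding V using not_ordLess_ordLeq by blast
    qed
  qed
  then obtain x where x: "\<And>i. good x i (x i)" by blast
  have "independent_along U I (\<lambda>i k. A i (branch_code (x i) k))"
    unfolding independent_along_def
  proof (intro allI impI)
    fix J and m m' :: "'i \<Rightarrow> nat" and C C'
    assume J: "finite J" "J \<subseteq> I"
      and "\<forall>\<^sub>F k in U. (\<Sum>i\<in>J. repeat_mset (m i) (A i (branch_code (x i) k))) + C
                    = (\<Sum>i\<in>J. repeat_mset (m' i) (A i (branch_code (x i) k))) + C'"
    then have ev: "\<forall>\<^sub>F k in U. Y x m J k + C = Y x m' J k + C'" by (simp add: Y_def)
    show "\<forall>i\<in>J. m i = m' i"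
    proof (rule ccontr)
      assume neg: "\<not> ?thesis"
      \<comment> \<open>Indices with equal coefficients cancel, so the greatest index that remains has distinct coefficients.\<close>
      define K where "K = {i \<in> J. m i \<noteq> m' i}"
      have K: "finite K" "K \<noteq> {}" using J neg by (auto simp: K_def)
      obtain i where i: "i \<in> K" "\<And>j. j \<in> K \<Longrightarrow> (j, i) \<in> r"
        using finite_set_has_greatest_of_linear_order[OF _ K, of r] wo by (auto simp: well_order_on_def)
      have split: "Y x m'' J k = Y x m'' (J - K) k + (repeat_mset (m'' i) (A i (branch_code (x i) k)) + Y x m'' (K - {i}) k)"
        for m'' k
      proof -
        have "Y x m'' J k = Y x m'' (J - K) k + Y x m'' K k"
          unfolding Y_def using J by (intro sum.subset_diff) (auto simp: K_def)
        then show ?thesis unfolding Y_def using sum.remove[OF K(1) i(1)] by simp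
      qed
      have same: "Y x m (J - K) k = Y x m' (J - K) k" for k
        unfolding Y_def by (intro sum.cong refl) (auto simp: K_def)
      have "dep x i (x i) (K - {i}) m m' (m i) (m' i) C C'"
        unfolding dep_def using ev by eventually_elim (simp add: split same add_ac)
      moreover have "K - {i} \<subseteq> underS r i" using i(2) by (auto simp: underS_def)
      moreover have "i \<in> I" "m i \<noteq> m' i" using i(1) J by (auto simp: K_def)
      ultimately show False using x[of i] K(1) unfolding good_def by blast
    qed
  qed
  then show ?thesis by blast
qed

section \<open>A free commutative monoid closed under formal limits\<close>

text \<open>
  Each sequence of multisets of generators is itself a generator; \<open>Origin\<close> starts the construction.
\<close>

datatype node = Origin | Limit "nat \<Rightarrow> node multiset"

text \<open>
  A sequence of lists of sets of numbers is coded by the lengths of the lists together with the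
  membership relations in their entries.  The lengths make the code non-empty, so the empty set remains
  available as a code for \<open>Origin\<close>.
\<close>

lemma list_sequence_code_exists:
  "\<exists>J :: (nat \<Rightarrow> nat set list) \<Rightarrow> nat set. inj J \<and> (\<forall>s. J s \<noteq> {})"
proof -
  define T :: "(nat \<Rightarrow> nat set list) \<Rightarrow> ((nat \<times> nat) + (nat \<times> nat \<times> nat)) set"
    where "T s = {Inl (n, length (s n)) | n. True} \<union> {Inr (n, i, b) | n i b. i < length (s n) \<and> b \<in> s n ! i}" for s
  define J where "J s = to_nat ` T s" for s
  have "s = t" if "J s = J t" for s t
  proof
    fix n
    have T: "T s = T t" using that by (simp add: J_def inj_image_eq_iff)
    have "Inl (n, length (s n)) \<in> T s" by (simp add: T_def)
    then have len: "length (s n) = length (t n)" unfolding T by (simp add: T_def)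
    have "s n ! i = t n ! i" if i: "i < length (s n)" for i
    proof -
      have "b \<in> s n ! i \<longleftrightarrow> Inr (n, i, b) \<in> T s" for b using i by (simp add: T_def)
      moreover have "b \<in> t n ! i \<longleftrightarrow> Inr (n, i, b) \<in> T t" for b using i len by (simp add: T_def)
      ultimately show ?thesis using T by blast
    qed
    with len show "s n = t n" by (rule nth_equalityI)
  qed
  moreover have "J s \<noteq> {}" for s by (auto simp: J_def T_def)
  ultimately show ?thesis by (auto simp: inj_def)
qed

lemma multiset_sequence_code_exists:
  "\<exists>J :: (nat \<Rightarrow> nat set multiset) \<Rightarrow> nat set. inj J \<and> (\<forall>s. J s \<noteq> {})"
proof -
  obtain J :: "(nat \<Rightarrow> nat set list) \<Rightarrow> nat set" where J: "inj J" "\<And>s. J s \<noteq> {}"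
    using list_sequence_code_exists by blast
  define l :: "nat set multiset \<Rightarrow> nat set list" where "l M = (SOME xs. mset xs = M)" for M
  have l: "mset (l M) = M" for M unfolding l_def by (rule someI_ex) (rule ex_mset)
  have "s = t" if "J (l \<circ> s) = J (l \<circ> t)" for s t
  proof
    fix n
    have "l \<circ> s = l \<circ> t" using J(1) that by (simp add: inj_eq)
    then have "mset (l (s n)) = mset (l (t n))" by (metis comp_apply)
    then show "s n = t n" by (simp add: l)
  qed
  then have "inj (\<lambda>s. J (l \<circ> s))" by (simp add: inj_def)
  then show ?thesis using J(2) by blast
qed

text \<open>
  An injective \<open>J\<close> that avoids the empty set yields an injection of \<open>node\<close> into the sets of
  numbers; this bounds the cardinality of \<open>node\<close> by the continuum.
\<close>

primrec node_code :: "((nat \<Rightarrow> nat set multiset) \<Rightarrow> nat set) \<Rightarrow> node \<Rightarrow> nat set" where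
  "node_code J Origin = {}"
| "node_code J (Limit a) = J (\<lambda>n. image_mset (node_code J) (a n))"

lemma image_mset_eqD:
  assumes "image_mset f A = image_mset f B" "\<And>x y. x \<in># A \<Longrightarrow> f x = f y \<Longrightarrow> x = y"
  shows "A = B"
  using assms
proof (induction A arbitrary: B)
  case empty
  then show ?case by simp
next
  case (add x A)
  have "f x \<in># image_mset f B" by (simp flip: add.prems(1))
  then obtain y where y: "y \<in># B" "f x = f y" by auto
  then have "x \<in># B" using add.prems(2)[of x y] by simp
  then obtain C where C: "B = add_mset x C" by (metis mset_add)
  have "A = C" using add.prems C by (intro add.IH) auto
  then show ?case using C by simp
qed

lemma inj_node_code:
  assumes "inj J" "\<And>s. J s \<noteq> {}"
  shows "inj (node_code J)"
proof -
  have "\<forall>y. node_code J x = node_code J y \<longrightarrow> x = y" for x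
  proof (induction x)
    case Origin
    show ?case
    proof (intro allI impI)
      fix y assume "node_code J Origin = node_code J y"
      then show "Origin = y" using assms(2) by (cases y) (auto dest: sym)
    qed
  next
    case (Limit a)
    show ?case
    proof (intro allI impI)
      fix y assume eq: "node_code J (Limit a) = node_code J y"
      show "Limit a = y"
      proof (cases y)
        case Origin
        then show ?thesis using eq assms(2) by simp
      next
        case (Limit b)
        then have "(\<lambda>n. image_mset (node_code J) (a n)) = (\<lambda>n. image_mset (node_code J) (b n))"
          using eq assms(1) by (simp add: inj_eq)
        then have im: "image_mset (node_code J) (a n) = image_mset (node_code J) (b n)" for n
          by (rule fun_cong)
        have "a n = b n" for n
          by (rule image_mset_eqD[OF im]) (use Limit.IH in blast)
        then show ?thesis using \<open>y = Limit b\<close> by auto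
      qed
    qed
  qed
  then show ?thesis by (auto simp: inj_def)
qed

lemma node_sequences_lepoll_nat_sets: "\<exists>c :: (nat \<Rightarrow> node multiset) \<Rightarrow> nat set. inj c"
proof -
  obtain J :: "(nat \<Rightarrow> nat set multiset) \<Rightarrow> nat set" where J: "inj J" "\<And>s. J s \<noteq> {}"
    using multiset_sequence_code_exists by blast
  have "inj (\<lambda>a. node_code J (Limit a))"
    by (rule injI) (use inj_node_code[OF J] in \<open>auto simp only: inj_eq node.inject\<close>)
  then show ?thesis by blast
qed

lemma node_multisets_inject_into_reals: "\<exists>c :: node multiset \<Rightarrow> real. inj c"
proof -
  obtain c :: "(nat \<Rightarrow> node multiset) \<Rightarrow> nat set" where c: "inj c"
    using node_sequences_lepoll_nat_sets by blast
  obtain f :: "nat set \<Rightarrow> real" where f: "inj f"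
    using nat_sets_eqpoll_reals unfolding eqpoll_def bij_betw_def by blast
  have "inj (\<lambda>M. f (c (\<lambda>_. M)))"
    by (rule injI) (use c f in \<open>auto simp only: inj_eq dest: fun_cong\<close>)
  then show ?thesis by blast
qed

text \<open>
  Outside \<open>E\<close> the limit condition on \<open>\<phi> (Limit a)\<close> serves as the definition of this value in
  terms of the values at the generators from which \<open>a\<close> is built.
\<close>

primrec extend_char ::
  "nat filter \<Rightarrow> ((nat \<Rightarrow> node multiset) \<Rightarrow> nat \<Rightarrow> nat) \<Rightarrow> node set \<Rightarrow> (node \<Rightarrow> complex) \<Rightarrow> node \<Rightarrow> complex" where
  "extend_char U h E \<phi> Origin = \<phi> Origin"
| "extend_char U h E \<phi> (Limit a) =
     (let b = (\<lambda>n. image_mset (extend_char U h E \<phi>) (a n)) in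
      if Limit a \<in> E then \<phi> (Limit a) else Lim U (\<lambda>k. prod_mset (b (h a k))))"

lemma extend_char_Limit:
  "extend_char U h E \<phi> (Limit a) =
     (if Limit a \<in> E then \<phi> (Limit a) else Lim U (\<lambda>k. char_ext (extend_char U h E \<phi>) (a (h a k))))"
  by (simp add: char_ext_def Let_def)

lemma extend_char_unimodular:
  assumes U: "ultrafilter U" and \<phi>: "unimodular \<phi>"
  shows "unimodular (extend_char U h E \<phi>)"
proof -
  define \<psi> where "\<psi> = extend_char U h E \<phi>"
  have "norm (\<psi> x) = 1" for x
  proof (induction x)
    case Origin
    then show ?case using \<phi> by (simp add: \<psi>_def unimodular_def)
  next
    case (Limit a)
    have "char_ext \<psi> (a n) \<in> sphere 0 1" for n
      using Limit.IH norm_char_ext_eq_1[of "a n" \<psi>] by auto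
    then obtain l where "l \<in> sphere 0 1" "((\<lambda>k. char_ext \<psi> (a (h a k))) \<longlongrightarrow> l) U"
      using ultrafilter_tendsto_compact[OF U compact_sphere, of "\<lambda>k. char_ext \<psi> (a (h a k))" 0 1] by blast
    moreover from this have "Lim U (\<lambda>k. char_ext \<psi> (a (h a k))) = l"
      using U by (intro tendsto_Lim) (auto simp: ultrafilter_def)
    ultimately show ?case
      using \<phi> unfolding \<psi>_def extend_char_Limit by (auto simp: unimodular_def)
  qed
  then show ?thesis by (simp add: unimodular_def \<psi>_def)
qed

text \<open>
  These are the characters that become continuous.  They force the sequence \<open>a (h a k)\<close> to converge to
  \<open>{#Limit a#}\<close> along \<open>U\<close>.
\<close>

definition limit_chars ::
  "nat filter \<Rightarrow> ((nat \<Rightarrow> node multiset) \<Rightarrow> nat \<Rightarrow> nat) \<Rightarrow> (node \<Rightarrow> complex) set" where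
  "limit_chars U h = {\<phi>. unimodular \<phi> \<and>
     (\<forall>a. inj a \<longrightarrow> ((\<lambda>k. char_ext \<phi> (a (h a k))) \<longlongrightarrow> \<phi> (Limit a)) U)}"

lemma extend_char_in_limit_chars:
  assumes U: "ultrafilter U" and \<phi>: "unimodular \<phi>"
    and E: "\<And>a k e. Limit a \<in> E \<Longrightarrow> e \<in># a k \<Longrightarrow> e \<in> E"
    and lim: "\<And>a. inj a \<Longrightarrow> Limit a \<in> E \<Longrightarrow> ((\<lambda>k. char_ext \<phi> (a (h a k))) \<longlongrightarrow> \<phi> (Limit a)) U"
  shows "extend_char U h E \<phi> \<in> limit_chars U h"
proof -
  define \<psi> where "\<psi> = extend_char U h E \<phi>"
  have uni: "unimodular \<psi>" unfolding \<psi>_def using U \<phi> by (rule extend_char_unimodular)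
  have agree: "\<psi> e = \<phi> e" if "e \<in> E" for e
    using that by (cases e) (simp_all add: \<psi>_def)
  have "((\<lambda>k. char_ext \<psi> (a (h a k))) \<longlongrightarrow> \<psi> (Limit a)) U" if a: "inj a" for a
  proof (cases "Limit a \<in> E")
    case True
    have "char_ext \<psi> (a n) = char_ext \<phi> (a n)" for n
      using agree E[OF True] by (intro char_ext_cong) blast
    then show ?thesis using lim[OF a True] agree[OF True] by simp
  next
    case False
    have "char_ext \<psi> (a n) \<in> sphere 0 1" for n
      using norm_char_ext[OF uni] by simp
    then obtain l where l: "((\<lambda>k. char_ext \<psi> (a (h a k))) \<longlongrightarrow> l) U"
      using ultrafilter_tendsto_compact[OF U compact_sphere, of "\<lambda>k. char_ext \<psi> (a (h a k))" 0 1] by blast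
    moreover from this have "Lim U (\<lambda>k. char_ext \<psi> (a (h a k))) = l"
      using U by (intro tendsto_Lim) (auto simp: ultrafilter_def)
    ultimately show ?thesis using False unfolding \<psi>_def extend_char_Limit by simp
  qed
  with uni show ?thesis by (simp add: limit_chars_def \<psi>_def)
qed

text \<open>
  The set \<open>E\<close> of generators that occur hereditarily in \<open>d\<close> or \<open>d'\<close> is countable, so a separating
  character exists there; it keeps its values on \<open>E\<close> when it is extended.
\<close>

lemma limit_chars_separate:
  assumes sel: "selective_ultrafilter U"
    and ind: "independent_along U {a. inj a} (\<lambda>a k. a (h a k))" and d: "d \<noteq> d'"
  shows "\<exists>\<psi>\<in>limit_chars U h. char_ext \<psi> d \<noteq> char_ext \<psi> d'"
proof -
  have U: "ultrafilter U" using sel by (auto simp: selective_ultrafilter_def free_ultrafilter_def)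
  define R where "R = {(Limit a, e) | a e. \<exists>n. e \<in># a n}"
  define E where "E = R\<^sup>* `` (set_mset d \<union> set_mset d')"
  have child: "countable (R `` {x})" for x
  proof (cases x)
    case Origin
    then have "R `` {x} = {}" by (auto simp: R_def)
    then show ?thesis by simp
  next
    case (Limit a)
    then have "R `` {x} = (\<Union>n. set_mset (a n))" by (auto simp: R_def)
    then show ?thesis by (simp add: countable_finite)
  qed
  have "countable (R `` Y)" if "countable Y" for Y
  proof -
    have "R `` Y = (\<Union>y\<in>Y. R `` {y})" by blast
    then show ?thesis using that child by simp
  qed
  then have "countable E"
    unfolding E_def by (rule countable_rtrancl) (auto intro: countable_finite)
  have closed: "e \<in> E" if "Limit a \<in> E" "e \<in># a k" for a k e
  proof -
    have "(Limit a, e) \<in> R" using that(2) by (auto simp: R_def)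
    then show ?thesis using that(1) unfolding E_def by (meson Image_iff rtrancl.rtrancl_into_rtrancl)
  qed
  define I where "I = {a. inj a \<and> Limit a \<in> E}"
  have "countable I"
  proof (rule countable_image_inj_on)
    show "countable (Limit ` I)" using \<open>countable E\<close> by (rule countable_subset[rotated]) (auto simp: I_def)
  qed (auto simp: inj_on_def)
  moreover have "independent_along U I (\<lambda>a k. a (h a k))"
    using ind unfolding independent_along_def I_def by blast
  ultimately obtain \<phi> where \<phi>: "unimodular \<phi>" "char_ext \<phi> d \<noteq> char_ext \<phi> d'"
    "\<And>a. a \<in> I \<Longrightarrow> ((\<lambda>k. char_ext \<phi> (a (h a k))) \<longlongrightarrow> \<phi> (Limit a)) U"
    using separating_character_exists[OF sel _ _ d, of I "\<lambda>a k. a (h a k)" Limit] by blast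
  define \<psi> where "\<psi> = extend_char U h E \<phi>"
  have "\<psi> \<in> limit_chars U h"
    unfolding \<psi>_def using \<phi>(3) closed by (intro extend_char_in_limit_chars[OF U \<phi>(1)]) (auto simp: I_def)
  moreover have "char_ext \<psi> M = char_ext \<phi> M" if "set_mset M \<subseteq> E" for M
  proof (rule char_ext_cong)
    fix e assume "e \<in># M"
    then have "e \<in> E" using that by blast
    then show "\<psi> e = \<phi> e" by (cases e) (simp_all add: \<psi>_def)
  qed
  moreover have "set_mset d \<subseteq> E" "set_mset d' \<subseteq> E" by (auto simp: E_def)
  ultimately show ?thesis using \<phi>(2) by (intro bexI[of _ \<psi>]) auto
qed

section \<open>The semigroup\<close>

lemma continuous_map_complex_mult:
  fixes f g :: "'a \<Rightarrow> complex"
  assumes "continuous_map X euclidean f" "continuous_map X euclidean g"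
  shows "continuous_map X euclidean (\<lambda>x. f x * g x)"
  using assms by (auto simp: continuous_map_atin intro!: tendsto_mult)

text \<open>
  The topology is pulled back along the map that sends a multiset to the family of its character values.
  A group structure would have the empty multiset as its identity, as this is the only idempotent, but a
  nonempty multiset has no inverse.
\<close>

lemma wallace_semigroup_from_characters:
  fixes X :: "('e \<Rightarrow> complex) set" and c :: "'e multiset \<Rightarrow> real"
  assumes c: "inj c"
    and separate: "\<And>M N. M \<noteq> N \<Longrightarrow> \<exists>\<phi>\<in>X. char_ext \<phi> M \<noteq> char_ext \<phi> N"
    and accumulate: "\<And>A. infinite A \<Longrightarrow> \<exists>U N (g :: nat \<Rightarrow> 'e multiset). U \<noteq> bot \<and> range g \<subseteq> A \<and>
       (\<forall>\<^sub>F k in U. g k \<noteq> N) \<and> (\<forall>\<phi>\<in>X. ((\<lambda>k. char_ext \<phi> (g k)) \<longlongrightarrow> char_ext \<phi> N) U)"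
  shows "\<exists>(T :: real topology) f. wallace_semigroup T f"
proof -
  define i where "i = the_inv c"
  have ic [simp]: "i (c M) = M" for M using c by (simp add: i_def the_inv_f_f)
  define F where "F x = (\<lambda>\<phi>. if \<phi> \<in> X then char_ext \<phi> (i x) else 0)" for x
  define T where "T = pullback_topology (range c) F euclidean"
  define f where "f x y = c (i x + i y)" for x y
  have top: "topspace T = range c" by (simp add: T_def topspace_pullback_topology)
  have openT: "openin T W \<longleftrightarrow> (\<exists>V. open V \<and> W = F -` V \<inter> range c)" for W
    by (simp add: T_def openin_pullback_topology)
  have sg: "semigroup_on (topspace T) f"
    by (auto simp: semigroup_on_def top f_def add.assoc)
  have canc: "cancellative_on (topspace T) f"
    using c by (auto simp: cancellative_on_def top f_def inj_eq)
  have "continuous_map T euclidean (id \<circ> F)"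
    unfolding T_def by (rule continuous_map_pullback) simp
  then have contF: "continuous_map T (product_topology (\<lambda>_. euclidean) UNIV) F"
    by (simp add: euclidean_product_topology)
  then have contF': "continuous_map T euclidean (\<lambda>x. F x \<phi>)" for \<phi>
    by (simp add: continuous_map_componentwise_UNIV)
  have cont: "continuous_map (prod_topology T T) T (\<lambda>(x, y). f x y)"
  proof -
    have "continuous_map (prod_topology T T) euclidean (\<lambda>p. F (fst p) \<phi> * F (snd p) \<phi>)" for \<phi>
      using continuous_map_compose[OF continuous_map_fst contF'] continuous_map_compose[OF continuous_map_snd contF']
      by (intro continuous_map_complex_mult) (simp_all add: comp_def)
    moreover have "F (f x y) \<phi> = F x \<phi> * F y \<phi>" for x y \<phi>
      by (simp add: F_def f_def)
    ultimately have "continuous_map (prod_topology T T) (product_topology (\<lambda>_. euclidean) UNIV) (F \<circ> (\<lambda>(x, y). f x y))"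
      by (simp add: continuous_map_componentwise_UNIV case_prod_beta comp_def)
    then have "continuous_map (prod_topology T T) euclidean (F \<circ> (\<lambda>(x, y). f x y))"
      by (simp add: euclidean_product_topology)
    moreover have "topspace (prod_topology T T) \<subseteq> (\<lambda>(x, y). f x y) -` range c"
      by (auto simp: f_def)
    ultimately have "continuous_map (prod_topology T T) (pullback_topology (range c) F euclidean) (\<lambda>(x, y). f x y)"
      by (rule continuous_map_pullback')
    then show ?thesis by (simp only: T_def [symmetric])
  qed
  have haus: "Hausdorff_space T"
    unfolding Hausdorff_space_def
  proof (intro allI impI)
    fix x y assume xy: "x \<in> topspace T \<and> y \<in> topspace T \<and> x \<noteq> y"
    then obtain M N where MN: "x = c M" "y = c N" "M \<noteq> N" by (auto simp: top)
    obtain \<phi> where "\<phi> \<in> X" "char_ext \<phi> M \<noteq> char_ext \<phi> N" using separate[OF MN(3)] by blast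
    then have "F x \<phi> \<noteq> F y \<phi>" using MN by (simp add: F_def)
    then obtain V W where VW: "open V" "open W" "F x \<phi> \<in> V" "F y \<phi> \<in> W" "V \<inter> W = {}"
      using separation_t2[of "F x \<phi>" "F y \<phi>"] by blast
    have "openin T {z \<in> topspace T. F z \<phi> \<in> V}" "openin T {z \<in> topspace T. F z \<phi> \<in> W}"
      using VW by (auto intro!: openin_continuous_map_preimage[OF contF'])
    then show "\<exists>U V. openin T U \<and> openin T V \<and> x \<in> U \<and> y \<in> V \<and> disjnt U V"
      using VW xy by (intro exI[of _ "{z \<in> topspace T. F z \<phi> \<in> V}"] exI[of _ "{z \<in> topspace T. F z \<phi> \<in> W}"])
        (auto simp: disjnt_def)
  qed
  have cc: "countably_compact_space T"
    unfolding countably_compact_space_def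
  proof (intro allI impI)
    fix A assume A: "A \<subseteq> topspace T" "infinite A"
    have "A = c ` (c -` A)" using A(1) by (auto simp: top)
    then have "infinite (c -` A)" using A(2) finite_imageI[of "c -` A" c] by auto
    from accumulate[OF this] obtain U N and g :: "nat \<Rightarrow> 'e multiset"
      where g: "U \<noteq> bot" "range g \<subseteq> c -` A" "\<forall>\<^sub>F k in U. g k \<noteq> N"
        "\<And>\<phi>. \<phi> \<in> X \<Longrightarrow> ((\<lambda>k. char_ext \<phi> (g k)) \<longlongrightarrow> char_ext \<phi> N) U" by blast
    have "limitin (product_topology (\<lambda>_. euclidean) UNIV) (\<lambda>k. F (c (g k))) (F (c N)) U"
      unfolding limitin_componentwise using g(4) by (auto simp: F_def)
    then have lim: "((\<lambda>k. F (c (g k))) \<longlongrightarrow> F (c N)) U"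
      by (simp add: euclidean_product_topology)
    have "c N \<in> T derived_set_of A"
      unfolding in_derived_set_of
    proof (intro conjI allI impI)
      show "c N \<in> topspace T" by (simp add: top)
      fix W assume W: "c N \<in> W \<and> openin T W"
      then obtain V where V: "open V" "W = F -` V \<inter> range c" by (auto simp: openT)
      with W have "F (c N) \<in> V" by auto
      with V(1) lim have "\<forall>\<^sub>F k in U. F (c (g k)) \<in> V" by (auto simp: tendsto_def)
      with g(3) have "\<forall>\<^sub>F k in U. g k \<noteq> N \<and> F (c (g k)) \<in> V" by (rule eventually_conj)
      then obtain k where "g k \<noteq> N" "F (c (g k)) \<in> V" using eventually_happens'[OF g(1)] by blast
      then show "\<exists>y. y \<noteq> c N \<and> y \<in> A \<and> y \<in> W"
        using g(2) V c by (intro exI[of _ "c (g k)"]) (auto simp: inj_eq)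
    qed
    then show "T derived_set_of A \<noteq> {}" by blast
  qed
  have "\<not> topological_group T f"
  proof
    assume "topological_group T f"
    then obtain e where G: "group \<lparr>carrier = topspace T, mult = f, one = e\<rparr>"
      unfolding topological_group_def Let_def by blast
    interpret group "\<lparr>carrier = topspace T, mult = f, one = e\<rparr>" by (rule G)
    have "e \<in> range c" "f e e = e" using one_closed l_one[OF one_closed] by (simp_all add: top)
    then have e: "e = c {#}" using c by (auto simp: f_def inj_eq)
    obtain y where "y \<in> range c" "f y (c {#undefined#}) = e"
      using l_inv_ex[of "c {#undefined#}"] by (auto simp: top)
    then show False using c unfolding e by (auto simp: f_def inj_eq)
  qed
  then have "wallace_semigroup T f"
    unfolding wallace_semigroup_def topological_semigroup_def using sg canc cont haus cc by blast
  then show ?thesis by blast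
qed

theorem theorem2p8:
  assumes "\<exists>U. selective_ultrafilter U"
  shows "\<exists>(X :: real topology) (f :: real \<Rightarrow> real \<Rightarrow> real). wallace_semigroup X f"
proof -
  obtain U where sel: "selective_ultrafilter U" using assms by blast
  have free: "free_ultrafilter U" and U: "ultrafilter U" and bot: "U \<noteq> bot"
    using sel by (auto simp: selective_ultrafilter_def free_ultrafilter_def ultrafilter_def)
  obtain c where c: "inj (c :: node multiset \<Rightarrow> real)"
    using node_multisets_inject_into_reals by blast
  have card: "(card_of (UNIV :: (nat \<Rightarrow> node multiset) set), card_of (UNIV :: nat set set)) \<in> ordLeq"
    using node_sequences_lepoll_nat_sets card_of_ordLeq by blast
  obtain x where ind: "independent_along U {a. inj a} (\<lambda>a k. a (branch_code (x a) k) :: node multiset)"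
    using independent_branches_exist[OF free _ card, of "{a. inj a}" "\<lambda>a. a"] by auto
  define h where "h a = branch_code (x a)" for a
  have ind: "independent_along U {a. inj a} (\<lambda>a k. a (h a k) :: node multiset)"
    using ind by (simp add: h_def)
  show ?thesis
  proof (rule wallace_semigroup_from_characters[OF c, where X = "limit_chars U h"])
    show "\<exists>\<phi>\<in>limit_chars U h. char_ext \<phi> M \<noteq> char_ext \<phi> N" if "M \<noteq> N" for M N
      using limit_chars_separate[OF sel ind that] .
  next
    fix A :: "node multiset set" assume "infinite A"
    then obtain a :: "nat \<Rightarrow> node multiset" where a: "inj a" "range a \<subseteq> A"
      using infinite_countable_subset by blast
    have "\<forall>\<^sub>F k in U. a (h a k) \<noteq> {#Limit a#}"
    proof (rule ccontr)
      assume "\<not> ?thesis"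
      then have "\<forall>\<^sub>F k in U. a (h a k) = {#Limit a#}"
        using ultrafilter_not_eventually[OF U] by auto
      \<comment> \<open>A constant sequence would satisfy a relation with a single term.\<close>
      then have "\<forall>\<^sub>F k in U. (\<Sum>i\<in>{a}. repeat_mset 1 (i (h i k))) + {#} = (\<Sum>i\<in>{a}. repeat_mset 0 (i (h i k))) + {#Limit a#}"
        by eventually_elim simp
      from ind[unfolded independent_along_def, rule_format, OF _ _ this] a(1) show False by simp
    qed
    then show "\<exists>V N (g :: nat \<Rightarrow> node multiset). V \<noteq> bot \<and> range g \<subseteq> A \<and>
       (\<forall>\<^sub>F k in V. g k \<noteq> N) \<and> (\<forall>\<phi>\<in>limit_chars U h. ((\<lambda>k. char_ext \<phi> (g k)) \<longlongrightarrow> char_ext \<phi> N) V)"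
      using a bot by (intro exI[of _ U] exI[of _ "{#Limit a#}"] exI[of _ "\<lambda>k. a (h a k)"])
        (auto simp: limit_chars_def)
  qed
qed

end
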